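(* Let $\alpha\in(0,1)$, $\beta>0$, $a_2>a_1>0$, $b_2>b_1>0$ satisfy $a_2b_1-a_1b_2=0$ and, for $i=1,2$, $$a_i> 2b_i\cosh\tfrac{\beta\pi}{2}\sqrt{1+\big(\cot\tfrac{\alpha\pi}{2}\tanh\tfrac{\beta\pi}{2}\big)^2},\qquad a_i> 2b_i\cosh\tfrac{\beta\pi}{2}\sqrt{1+\big(\tan\tfrac{\alpha\pi}{2}\tanh\tfrac{\beta\pi}{2}\big)^2}.$$ Let $$M(s)=\sqrt{\frac{1+a_1s^\alpha+b_1(s^{\alpha+i\beta}+s^{\alpha-i\beta})}{1+a_2s^\alpha+b_2(s^{\alpha+i\beta}+s^{\alpha-i\beta})}},\qquad \operatorname{Re}s\ge0,\ s\ne0,\qquad M(0)=1,$$ and, for some $s_0>0$, let $$K(x,t)=\frac1{2\pi i}\int_{s_0-i\infty}^{s_0+i\infty}e^{ts}e^{-sM(s)x}\,ds .$$ Then $$K(x,t)=\frac1\pi\int_0^\infty \exp\big[\tau\,\operatorname{Im}M(i\tau)\,x\big]\cos\big[\tau\,(t-\operatorname{Re}M(i\tau)\,x)\big]\,d\tau,\qquad x>0,\ t>0,$$ and $K$ is a continuous function of $x$. If $x=0$ then $K(0,t)=\delta(t)$, the Dirac distribution.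
   Context: Complex powers $s^\alpha$, $s^{\alpha\pm i\beta}$ are taken with the principal branch (so $\arg(i\tau)=\pi/2$ for $\tau>0$), and the square root defining $M$ is the one with positive real part. $K$ is the kernel (inverse Laplace transform in $t$ of $e^{-sM(s)x}$) of the solution $u=U*_tK$ of the wave problem on the half-line $x\in[0,\infty)$, i.e. the case of rod length $l=\infty$; for $x=0$ the defining integral is the inverse Laplace transform of $1$ in the sense of distributions. *)

theory Defs
  imports "HOL-Complex_Analysis.Complex_Analysis"
begin

text \<open>
  Library conventions used below: complex \<open>powr\<close> is the principal power (argument in \<open>(-\<pi>, \<pi>]\<close>),
  and \<open>csqrt z\<close> has positive real part unless \<open>z\<close> is a nonpositive real number.
\<close>

definition visc :: "real \<Rightarrow> real \<Rightarrow> real \<Rightarrow> real \<Rightarrow> complex \<Rightarrow> complex" where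
  "visc \<alpha> \<beta> a b s =
     1 + of_real a * s powr of_real \<alpha>
       + of_real b * (s powr (of_real \<alpha> + \<i> * of_real \<beta>) + s powr (of_real \<alpha> - \<i> * of_real \<beta>))"

definition M :: "real \<Rightarrow> real \<Rightarrow> real \<Rightarrow> real \<Rightarrow> real \<Rightarrow> real \<Rightarrow> complex \<Rightarrow> complex" where
  "M \<alpha> \<beta> a\<^sub>1 b\<^sub>1 a\<^sub>2 b\<^sub>2 s =
     (if s = 0 then 1 else csqrt (visc \<alpha> \<beta> a\<^sub>1 b\<^sub>1 s / visc \<alpha> \<beta> a\<^sub>2 b\<^sub>2 s))"

definition K_hat :: "real \<Rightarrow> real \<Rightarrow> real \<Rightarrow> real \<Rightarrow> real \<Rightarrow> real \<Rightarrow> real \<Rightarrow> complex \<Rightarrow> complex" where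
  "K_hat \<alpha> \<beta> a\<^sub>1 b\<^sub>1 a\<^sub>2 b\<^sub>2 x s = exp (- s * M \<alpha> \<beta> a\<^sub>1 b\<^sub>1 a\<^sub>2 b\<^sub>2 s * of_real x)"

text \<open>
  The integral of \<open>F\<close> along the upward line \<open>Re s = s\<^sub>0\<close> is a Lebesgue integral, parametrised by
  \<open>s = s\<^sub>0 + \<i> \<tau>\<close>, \<open>ds = \<i> d\<tau>\<close>. The Bochner integral of a non-integrable function is \<open>0\<close>, so
  \<open>line_integrable\<close> has to be asserted along with the value.
\<close>

definition line_integrable :: "real \<Rightarrow> (complex \<Rightarrow> complex) \<Rightarrow> bool" where
  "line_integrable s\<^sub>0 F \<longleftrightarrow> integrable lborel (\<lambda>\<tau>::real. F (Complex s\<^sub>0 \<tau>) * \<i>)"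

definition line_integral :: "real \<Rightarrow> (complex \<Rightarrow> complex) \<Rightarrow> complex" where
  "line_integral s\<^sub>0 F = (LINT \<tau>|lborel. F (Complex s\<^sub>0 \<tau>) * \<i>)"

definition inv_laplace :: "real \<Rightarrow> (complex \<Rightarrow> complex) \<Rightarrow> real \<Rightarrow> complex" where
  "inv_laplace s\<^sub>0 F t = 1 / (2 * of_real pi * \<i>) * line_integral s\<^sub>0 (\<lambda>s. exp (of_real t * s) * F s)"

definition K :: "real \<Rightarrow> real \<Rightarrow> real \<Rightarrow> real \<Rightarrow> real \<Rightarrow> real \<Rightarrow> real \<Rightarrow> real \<Rightarrow> real \<Rightarrow> complex" where
  "K \<alpha> \<beta> a\<^sub>1 b\<^sub>1 a\<^sub>2 b\<^sub>2 s\<^sub>0 x t = inv_laplace s\<^sub>0 (K_hat \<alpha> \<beta> a\<^sub>1 b\<^sub>1 a\<^sub>2 b\<^sub>2 x) t"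

text \<open>Distributions on the real line are functionals on the test functions, i.e. on the smooth
  complex-valued functions with compact support.\<close>

definition test_function :: "(real \<Rightarrow> complex) \<Rightarrow> bool" where
  "test_function \<phi> \<longleftrightarrow>
     (\<exists>D :: nat \<Rightarrow> real \<Rightarrow> complex. D 0 = \<phi> \<and>
        (\<forall>n t. (D n has_vector_derivative D (Suc n) t) (at t))) \<and>
     compact (closure {t. \<phi> t \<noteq> 0})"

text \<open>
  The inverse Laplace integral in the sense of distributions: the line integral of the
  distribution-valued function \<open>s \<mapsto> F s \<cdot> e\<^sup>t\<^sup>s\<close>, where \<open>e\<^sup>t\<^sup>s\<close> stands for the regular
  distribution \<open>\<phi> \<mapsto> \<integral> e\<^sup>t\<^sup>s \<phi>(t) dt\<close>, is evaluated by pairing with \<open>\<phi>\<close> under the line integral.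
\<close>

definition exp_distr :: "complex \<Rightarrow> (real \<Rightarrow> complex) \<Rightarrow> complex" where
  "exp_distr s \<phi> = (LINT t|lborel. exp (of_real t * s) * \<phi> t)"

definition inv_laplace_distr :: "real \<Rightarrow> (complex \<Rightarrow> complex) \<Rightarrow> (real \<Rightarrow> complex) \<Rightarrow> complex" where
  "inv_laplace_distr s\<^sub>0 F \<phi> = 1 / (2 * of_real pi * \<i>) * line_integral s\<^sub>0 (\<lambda>s. exp_distr s \<phi> * F s)"

definition K_distr ::
    "real \<Rightarrow> real \<Rightarrow> real \<Rightarrow> real \<Rightarrow> real \<Rightarrow> real \<Rightarrow> real \<Rightarrow> real \<Rightarrow> (real \<Rightarrow> complex) \<Rightarrow> complex" where
  "K_distr \<alpha> \<beta> a\<^sub>1 b\<^sub>1 a\<^sub>2 b\<^sub>2 s\<^sub>0 x = inv_laplace_distr s\<^sub>0 (K_hat \<alpha> \<beta> a\<^sub>1 b\<^sub>1 a\<^sub>2 b\<^sub>2 x)"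

definition dirac :: "(real \<Rightarrow> complex) \<Rightarrow> complex" where
  "dirac \<phi> = \<phi> 0"

end

theory Submission
  imports Defs "HOL-Probability.Sinc_Integral" "HOL-Real_Asymp.Real_Asymp"
begin

text \<open>
  Since \<open>a\<^sub>1 / b\<^sub>1 = a\<^sub>2 / b\<^sub>2\<close>, both viscoelastic factors have the form \<open>1 + b\<^sub>i g\<close> with the same
  \<open>g\<close>, so that \<open>M\<^sup>2 = k + (1 - k) / (1 + b\<^sub>2 g)\<close> with \<open>k = b\<^sub>1 / b\<^sub>2 \<in> (0, 1)\<close>. The condition with the tangent
  gives \<open>Re g \<ge> 0\<close> on the closed right half-plane, whence \<open>Re M\<^sup>2 > 0\<close> and \<open>|M| \<le> 1\<close>. The condition with
  the cotangent gives \<open>Im g \<ge> c |s|\<^sup>\<alpha>\<close> near the imaginary axis, whence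
  \<open>Re (s M(s)) \<ge> c |Im s|\<^bsup>1-\<alpha>\<^esup> - C\<close> on the strip \<open>0 \<le> Re s \<le> s\<^sub>0\<close>. This bound lets the line of
  integration be moved to the imaginary axis, where conjugate symmetry yields the real integral, and it
  dominates the integrand locally uniformly in \<open>x > 0\<close>.
  For \<open>x = 0\<close> the claim is Fourier inversion at \<open>0\<close> for \<open>e\<^bsup>s\<^sub>0t\<^esup> \<phi>(t)\<close>; integrating by parts turns the Dirichlet
  kernel into the sine integral, which converges boundedly to a multiple of \<open>sgn t\<close>.
\<close>

section \<open>Bounds on the symbol\<close>

text \<open>Cauchy-Schwarz against the unit vector \<open>(cos u, sin u)\<close>. It removes the
  oscillation in \<open>u = \<beta> * ln (norm s)\<close>, which takes every value as
  \<open>norm s\<close> varies.\<close>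

lemma abs_cos_sin_le: "\<bar>p * cos u + q * sin u\<bar> \<le> sqrt (p\<^sup>2 + q\<^sup>2)" for p q u :: real
proof (rule real_le_rsqrt)
  have "(p * cos u + q * sin u)\<^sup>2 + (p * sin u - q * cos u)\<^sup>2 = (p\<^sup>2 + q\<^sup>2) * ((sin u)\<^sup>2 + (cos u)\<^sup>2)"
    by (simp only: power2_eq_square) algebra
  then have "(p * cos u + q * sin u)\<^sup>2 + (p * sin u - q * cos u)\<^sup>2 = p\<^sup>2 + q\<^sup>2"
    by simp
  then show "\<bar>p * cos u + q * sin u\<bar>\<^sup>2 \<le> p\<^sup>2 + q\<^sup>2"
    unfolding power2_abs by (metis le_add_same_cancel1 zero_le_power2)
qed

text \<open>With \<open>l = a / b\<close> this is the non-constant part of \<open>visc\<close>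
  divided by \<open>b\<close>. Proportional coefficients give both factors the same
  \<open>l\<close>, hence the same function.\<close>

definition osc :: "real \<Rightarrow> real \<Rightarrow> real \<Rightarrow> complex \<Rightarrow> complex" where
  "osc \<alpha> \<beta> l s = of_real l * s powr of_real \<alpha>
     + (s powr (of_real \<alpha> + \<i> * of_real \<beta>) + s powr (of_real \<alpha> - \<i> * of_real \<beta>))"

lemma visc_eq_osc:
  assumes "b \<noteq> 0"
  shows "visc \<alpha> \<beta> a b s = 1 + of_real b * osc \<alpha> \<beta> (a / b) s"
  using assms by (simp add: visc_def osc_def field_simps)

text \<open>Insert \<open>Ln s = ln (norm s) + \<i> * Arg s\<close>: the imaginary part of the
  exponent scales the modulus through \<open>Arg s\<close> and turns the phase through
  \<open>ln (norm s)\<close>. The sign of \<open>r\<close> is free, so that both conjugate exponents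
  and the purely real one are instances.\<close>

lemma powr_polar:
  assumes "s \<noteq> 0"
  shows "s powr (of_real \<alpha> + \<i> * of_real r)
    = of_real (norm s powr \<alpha> * exp (- (r * Arg s))) * cis (\<alpha> * Arg s + r * ln (norm s))"
proof -
  have Ln: "Ln s = Complex (ln (norm s)) (Arg s)"
    using assms by (simp add: complex_eq_iff Arg_eq_Im_Ln)
  have "(of_real \<alpha> + \<i> * of_real r) * Ln s
      = of_real (\<alpha> * ln (norm s) + - (r * Arg s)) + \<i> * of_real (\<alpha> * Arg s + r * ln (norm s))"
    unfolding Ln by (simp add: complex_eq_iff algebra_simps)
  moreover have "exp (of_real x + \<i> * of_real y) = of_real (exp x) * cis y" for x y
    by (simp add: exp_add cis_conv_exp exp_of_real)
  moreover have "norm s powr \<alpha> * exp (- (r * Arg s)) = exp (\<alpha> * ln (norm s) + - (r * Arg s))"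
    unfolding exp_add using assms by (simp add: powr_def)
  ultimately show ?thesis
    using assms by (simp only: powr_def if_False)
qed

text \<open>The two conjugate exponents carry amplitudes \<open>exp (- v)\<close>,
  \<open>exp v\<close> and phases \<open>a + u\<close>, \<open>a - u\<close>. The addition formulas
  collect the exponentials into \<open>cosh\<close> and \<open>sinh\<close>, leaving a linear
  combination of \<open>cos u\<close> and \<open>sin u\<close> to which
  \<open>abs_cos_sin_le\<close> applies.\<close>

lemma
  assumes "s \<noteq> 0"
  shows Re_osc: "Re (osc \<alpha> \<beta> l s) = norm s powr \<alpha> * (l * cos (\<alpha> * Arg s)
            + 2 * (cosh (\<beta> * Arg s) * cos (\<alpha> * Arg s) * cos (\<beta> * ln (norm s))
                 + sinh (\<beta> * Arg s) * sin (\<alpha> * Arg s) * sin (\<beta> * ln (norm s))))"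
    and Im_osc: "Im (osc \<alpha> \<beta> l s) = norm s powr \<alpha> * (l * sin (\<alpha> * Arg s)
            + 2 * (cosh (\<beta> * Arg s) * sin (\<alpha> * Arg s) * cos (\<beta> * ln (norm s))
                 - sinh (\<beta> * Arg s) * cos (\<alpha> * Arg s) * sin (\<beta> * ln (norm s))))"
proof -
  define \<rho> a v u where "\<rho> = norm s powr \<alpha>" and "a = \<alpha> * Arg s" and "v = \<beta> * Arg s"
    and "u = \<beta> * ln (norm s)"
  have *: "osc \<alpha> \<beta> l s = of_real l * (of_real \<rho> * cis a)
      + (of_real (\<rho> * exp (- v)) * cis (a + u) + of_real (\<rho> * exp v) * cis (a - u))"
    unfolding osc_def \<rho>_def a_def v_def u_def
    using powr_polar[OF assms, of \<alpha> 0] powr_polar[OF assms, of \<alpha> \<beta>] powr_polar[OF assms, of \<alpha> "- \<beta>"]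
    by simp
  have cosh: "2 * cosh v = exp v + exp (- v)" and sinh: "2 * sinh v = exp v - exp (- v)"
    by (simp_all add: cosh_def sinh_def)
  have "Re (osc \<alpha> \<beta> l s) = \<rho> * (l * cos a + ((2 * cosh v) * cos a * cos u + (2 * sinh v) * sin a * sin u))"
    unfolding * cosh sinh by (simp add: cos_add cos_diff algebra_simps)
  then show "Re (osc \<alpha> \<beta> l s) = norm s powr \<alpha> * (l * cos (\<alpha> * Arg s)
            + 2 * (cosh (\<beta> * Arg s) * cos (\<alpha> * Arg s) * cos (\<beta> * ln (norm s))
                 + sinh (\<beta> * Arg s) * sin (\<alpha> * Arg s) * sin (\<beta> * ln (norm s))))"
    by (simp add: \<rho>_def a_def v_def u_def)
  have "Im (osc \<alpha> \<beta> l s) = \<rho> * (l * sin a + ((2 * cosh v) * sin a * cos u - (2 * sinh v) * cos a * sin u))"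
    unfolding * cosh sinh by (simp add: sin_add sin_diff algebra_simps)
  then show "Im (osc \<alpha> \<beta> l s) = norm s powr \<alpha> * (l * sin (\<alpha> * Arg s)
            + 2 * (cosh (\<beta> * Arg s) * sin (\<alpha> * Arg s) * cos (\<beta> * ln (norm s))
                 - sinh (\<beta> * Arg s) * cos (\<alpha> * Arg s) * sin (\<beta> * ln (norm s))))"
    by (simp add: \<rho>_def a_def v_def u_def)
qed

text \<open>In the right half-plane \<open>\<bar>Arg s\<bar> \<le> pi / 2\<close>, so the amplitudes
  of the complex powers stay bounded. This is the upper counterpart of the lower bound on the
  imaginary part: both are of order \<open>norm s powr \<alpha>\<close>.\<close>

lemma norm_osc_le:
  assumes "Re s \<ge> 0" "s \<noteq> 0" "\<beta> \<ge> 0" "l \<ge> 0"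
  shows "norm (osc \<alpha> \<beta> l s) \<le> (l + 2 * exp (\<beta> * pi / 2)) * norm s powr \<alpha>"
proof -
  have arg: "\<bar>Arg s\<bar> \<le> pi / 2"
    using assms Arg_Re_nonneg by blast
  have "norm (s powr (of_real \<alpha> + \<i> * of_real r)) \<le> norm s powr \<alpha> * exp (\<beta> * pi / 2)"
    if "\<bar>r\<bar> = \<beta>" for r
  proof -
    have "norm (s powr (of_real \<alpha> + \<i> * of_real r)) = norm s powr \<alpha> * exp (- (r * Arg s))"
      unfolding powr_polar[OF \<open>s \<noteq> 0\<close>] by (simp add: norm_mult)
    moreover have "\<bar>r * Arg s\<bar> \<le> \<beta> * (pi / 2)"
      unfolding abs_mult that using arg assms by (intro mult_left_mono) auto
    ultimately show ?thesis
      by (auto intro!: mult_left_mono)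
  qed
  from this[of \<beta>] this[of "- \<beta>"] assms
  have "norm (s powr (of_real \<alpha> + \<i> * of_real \<beta>)) \<le> norm s powr \<alpha> * exp (\<beta> * pi / 2)"
    "norm (s powr (of_real \<alpha> - \<i> * of_real \<beta>)) \<le> norm s powr \<alpha> * exp (\<beta> * pi / 2)"
    by auto
  moreover have "norm (of_real l * s powr of_real \<alpha>) = l * norm s powr \<alpha>"
    using assms by (simp add: norm_mult norm_powr_real_powr')
  ultimately show ?thesis
    unfolding osc_def
    by (smt (verit, best) norm_triangle_ineq distrib_right mult.commute mult.left_commute)
qed

text \<open>The hypotheses of the theorem speak only of the extreme angle \<open>pi / 2\<close>.
  Monotonicity of each factor in \<open>\<bar>a\<bar>\<close> and \<open>\<bar>v\<bar>\<close>
  transfers them to every angle of the half-plane.\<close>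

lemma cosh_sqrt_tan_tanh_mono:
  fixes a A v V :: real
  assumes "\<bar>a\<bar> \<le> A" "A < pi / 2" "\<bar>v\<bar> \<le> V"
  shows "cosh v * sqrt (1 + (tan a * tanh v)\<^sup>2) \<le> cosh V * sqrt (1 + (tan A * tanh V)\<^sup>2)"
proof -
  have "cosh v \<le> cosh V"
    using cosh_real_nonneg_le_iff[of "\<bar>v\<bar>" V] assms by simp
  moreover have "\<bar>tan a\<bar> \<le> \<bar>tan A\<bar>"
  proof -
    have "tan \<bar>a\<bar> \<le> tan A"
      using assms by (intro tan_mono_le) auto
    moreover have "\<bar>tan a\<bar> = tan \<bar>a\<bar>"
      using assms tan_pos_pi2_le[of "\<bar>a\<bar>"] by (cases "a \<ge> 0") auto
    ultimately show ?thesis by simp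
  qed
  moreover have "\<bar>tanh v\<bar> \<le> \<bar>tanh V\<bar>"
    using assms by (smt (verit) tanh_real_le_iff tanh_minus tanh_real_nonneg_iff)
  ultimately have "(tan a * tanh v)\<^sup>2 \<le> (tan A * tanh V)\<^sup>2"
    unfolding abs_le_square_iff [symmetric] abs_mult by (intro mult_mono) auto
  with \<open>cosh v \<le> cosh V\<close> show ?thesis
    by (intro mult_mono real_sqrt_le_mono) auto
qed

lemma Re_osc_nonneg:
  assumes "Re s \<ge> 0" "0 < \<alpha>" "\<alpha> < 1" "0 \<le> \<beta>"
    and l: "l \<ge> 2 * cosh (\<beta> * pi / 2) * sqrt (1 + (tan (\<alpha> * pi / 2) * tanh (\<beta> * pi / 2))\<^sup>2)"
  shows "Re (osc \<alpha> \<beta> l s) \<ge> 0"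
proof (cases "s = 0")
  case False
  define a v where "a = \<alpha> * Arg s" and "v = \<beta> * Arg s"
  have "\<bar>Arg s\<bar> \<le> pi / 2"
    using assms Arg_Re_nonneg by blast
  then have a: "\<bar>a\<bar> \<le> \<alpha> * pi / 2" and v: "\<bar>v\<bar> \<le> \<beta> * pi / 2"
    using assms mult_left_mono[of "\<bar>Arg s\<bar>" "pi / 2"] by (simp_all add: a_def v_def abs_mult)
  have A: "\<alpha> * pi / 2 < pi / 2"
    using assms by simp
  have cos: "cos a > 0"
    by (intro cos_gt_zero_pi; use a A in linarith)
  \<comment> \<open>This is the largest size of the oscillating part of \<open>Re_osc\<close>.
    Pulling out \<open>cos a > 0\<close> produces the tangent expression of the hypothesis.\<close>
  have "2 * sqrt ((cosh v * cos a)\<^sup>2 + (sinh v * sin a)\<^sup>2) = 2 * (cosh v * sqrt (1 + (tan a * tanh v)\<^sup>2)) * cos a"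
  proof -
    have "(cosh v * cos a)\<^sup>2 + (sinh v * sin a)\<^sup>2 = (cosh v * cos a)\<^sup>2 * (1 + (tan a * tanh v)\<^sup>2)"
      using cos by (simp add: tan_def tanh_def field_simps)
    then show ?thesis
      using cos by (simp add: real_sqrt_mult)
  qed
  also have "\<dots> \<le> l * cos a"
    using cosh_sqrt_tan_tanh_mono[OF a A v] l cos by (intro mult_right_mono) auto
  finally show ?thesis
    using abs_cos_sin_le[of "cosh v * cos a" "\<beta> * ln (norm s)" "sinh v * sin a"]
    unfolding Re_osc[OF False] a_def v_def by (intro mult_nonneg_nonneg) auto
qed (simp add: osc_def)

text \<open>At angle \<open>pi / 2\<close> the cotangent condition leaves a strict gap, and
  continuity in the angle keeps half of it nearby. Within a strip of bounded width, a large
  imaginary part forces the angle close to \<open>pi / 2\<close>.\<close>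

lemma Im_osc_lower_bound:
  assumes "0 < \<alpha>" "\<alpha> < 1" "0 \<le> \<beta>" "0 \<le> p0"
    and l: "l > 2 * cosh (\<beta> * pi / 2) * sqrt (1 + (cot (\<alpha> * pi / 2) * tanh (\<beta> * pi / 2))\<^sup>2)"
  shows "\<exists>c>0. \<exists>R>0. \<forall>s. 0 \<le> Re s \<and> Re s \<le> p0 \<and> R \<le> Im s \<longrightarrow> c * norm s powr \<alpha> \<le> Im (osc \<alpha> \<beta> l s)"
proof -
  \<comment> \<open>The minimum over the phase of
    \<open>Im (osc \<alpha> \<beta> l s) / norm s powr \<alpha>\<close> at the angle
    \<open>\<theta>\<close>.\<close>
  define h where "h \<theta> = l * sin (\<alpha> * \<theta>)
     - 2 * sqrt ((cosh (\<beta> * \<theta>) * sin (\<alpha> * \<theta>))\<^sup>2 + (sinh (\<beta> * \<theta>) * cos (\<alpha> * \<theta>))\<^sup>2)" for \<theta>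
  define a v where "a = \<alpha> * pi / 2" and "v = \<beta> * pi / 2"
  have "0 < a" "a < pi" using assms by (auto simp: a_def)
  then have sin: "sin a > 0" by (rule sin_gt_zero)
  have "(cosh v * sin a)\<^sup>2 + (sinh v * cos a)\<^sup>2 = (cosh v * sin a)\<^sup>2 * (1 + (cot a * tanh v)\<^sup>2)"
    using sin by (simp add: cot_def tanh_def field_simps)
  then have "2 * sqrt ((cosh v * sin a)\<^sup>2 + (sinh v * cos a)\<^sup>2) = 2 * cosh v * sqrt (1 + (cot a * tanh v)\<^sup>2) * sin a"
    using sin by (simp add: real_sqrt_mult)
  also have "\<dots> < l * sin a"
    using l sin by (intro mult_strict_right_mono) (auto simp: a_def v_def)
  finally have h0: "h (pi / 2) > 0"
    by (simp add: h_def a_def v_def)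
  have "isCont h (pi / 2)"
    unfolding h_def by (intro continuous_intros)
  then obtain \<delta> where \<delta>: "\<delta> > 0" "\<And>\<theta>. \<bar>\<theta> - pi / 2\<bar> < \<delta> \<Longrightarrow> \<bar>h \<theta> - h (pi / 2)\<bar> < h (pi / 2) / 2"
    using h0 unfolding continuous_at_eps_delta dist_real_def by (metis half_gt_zero)
  define \<epsilon> where "\<epsilon> = min \<delta> (pi / 2)"
  have \<epsilon>: "0 < \<epsilon>" "\<epsilon> \<le> \<delta>" "\<epsilon> \<le> pi / 2"
    using \<delta> by (auto simp: \<epsilon>_def)
  have sin\<epsilon>: "sin \<epsilon> > 0"
    using \<epsilon> by (intro sin_gt_zero) auto
  \<comment> \<open>Chosen so that \<open>R * sin \<epsilon> = p0 + 1\<close>. An angle further than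
    \<open>\<epsilon>\<close> from \<open>pi / 2\<close> would give
    \<open>Re s \<ge> sin \<epsilon> * norm s \<ge> R * sin \<epsilon>\<close>, beyond the
    strip.\<close>
  define R where "R = (p0 + 1) / sin \<epsilon>"
  have R: "R > 0" "p0 < R * sin \<epsilon>"
    using sin\<epsilon> assms by (auto simp: R_def)
  have "h (pi / 2) / 2 * norm s powr \<alpha> \<le> Im (osc \<alpha> \<beta> l s)"
    if s: "0 \<le> Re s" "Re s \<le> p0" "R \<le> Im s" for s
  proof -
    have "s \<noteq> 0" using s R by auto
    have arg: "\<bar>Arg s\<bar> \<le> pi / 2" "0 \<le> Arg s"
      using s R Arg_Re_nonneg Arg_less_0 by force+
    have "pi / 2 - \<epsilon> < Arg s"
    proof (rule ccontr)
      assume "\<not> pi / 2 - \<epsilon> < Arg s"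
      then have "cos (pi / 2 - \<epsilon>) \<le> cos (Arg s)"
        using arg \<epsilon> by (intro cos_monotone_0_pi_le) auto
      moreover have "cos (pi / 2 - \<epsilon>) = sin \<epsilon>"
        by (simp add: cos_diff)
      ultimately have "sin \<epsilon> * norm s \<le> Re s"
        using \<open>s \<noteq> 0\<close> by (simp add: cos_Arg field_simps)
      moreover have "R \<le> norm s"
        using s abs_Im_le_cmod[of s] by linarith
      then have "R * sin \<epsilon> \<le> sin \<epsilon> * norm s"
        using sin\<epsilon> by simp
      ultimately show False using R s by linarith
    qed
    then have "\<bar>Arg s - pi / 2\<bar> < \<delta>"
      using arg \<epsilon> by linarith
    from \<delta>(2)[OF this] have "h (Arg s) \<ge> h (pi / 2) / 2"
      by linarith
    then have "h (pi / 2) / 2 * norm s powr \<alpha> \<le> norm s powr \<alpha> * h (Arg s)"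
      unfolding mult.commute[of _ "norm s powr \<alpha>"] by (intro mult_left_mono) auto
    also have "\<dots> \<le> Im (osc \<alpha> \<beta> l s)"
      unfolding Im_osc[OF \<open>s \<noteq> 0\<close>] h_def
      using abs_cos_sin_le[of "cosh (\<beta> * Arg s) * sin (\<alpha> * Arg s)" "\<beta> * ln (norm s)" "- sinh (\<beta> * Arg s) * cos (\<alpha> * Arg s)"]
      by (intro mult_left_mono) auto
    finally show ?thesis .
  qed
  with h0 R show ?thesis
    by (intro exI[of _ "h (pi / 2) / 2"] conjI exI[of _ R]) auto
qed


text \<open>Equal ratios turn the quotient into \<open>(1 + b1 g) / (1 + b2 g)\<close>, a constant
  plus a multiple of a reciprocal. The denominator has positive real part and so does not
  vanish.\<close>

lemma M_eq_csqrt: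
  fixes a1 a2 b1 b2 :: real
  assumes "0 < b1" "0 < b2" "a2 * b1 = a1 * b2" and "Re (osc \<alpha> \<beta> (a1 / b1) s) \<ge> 0"
  defines "g \<equiv> osc \<alpha> \<beta> (a1 / b1) s"
  shows "M \<alpha> \<beta> a1 b1 a2 b2 s = csqrt (of_real (b1 / b2) + of_real (1 - b1 / b2) / (1 + of_real b2 * g))"
proof -
  have "a2 / b2 = a1 / b1"
    using assms by (simp add: field_simps)
  then have v: "visc \<alpha> \<beta> a1 b1 s = 1 + of_real b1 * g" "visc \<alpha> \<beta> a2 b2 s = 1 + of_real b2 * g"
    using assms visc_eq_osc[of b1 \<alpha> \<beta> a1 s] visc_eq_osc[of b2 \<alpha> \<beta> a2 s] by (simp_all add: g_def)
  have "Re (1 + of_real b2 * g) > 0"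
    using assms by (simp add: add_pos_nonneg)
  then have nz: "1 + of_real b2 * g \<noteq> 0"
    by (metis less_irrefl zero_complex.simps(1))
  have q: "(1 + of_real b1 * g) / (1 + of_real b2 * g)
      = of_real (b1 / b2) + of_real (1 - b1 / b2) / (1 + of_real b2 * g)"
    using nz assms by (simp add: divide_simps) (simp add: algebra_simps)
  \<comment> \<open>Powers of 0 are 0, so the radicand at the origin is 1, in agreement with the
    separate value in the definition of \<open>M\<close>.\<close>
  have "s = 0 \<Longrightarrow> g = 0"
    by (simp add: g_def osc_def)
  with nz assms show ?thesis
    unfolding M_def v q by auto
qed

text \<open>Inversion maps the half-plane \<open>Re w \<ge> 1\<close> into the closed disc with
  diameter from 0 to 1. A proper convex combination of 1 and \<open>1 / w\<close> thus stays in the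
  unit disc and in the open right half-plane; its imaginary part has the sign opposite to that of
  \<open>w\<close>.\<close>

lemma Re_convex_recip_pos:
  fixes w :: complex and k :: real
  assumes "0 < k" "k < 1" "Re w \<ge> 1"
  shows "Re (of_real k + of_real (1 - k) / w) > 0"
    and "norm (of_real k + of_real (1 - k) / w) \<le> 1"
    and "Im (of_real k + of_real (1 - k) / w) = - ((1 - k) * Im w / (norm w)\<^sup>2)"
proof -
  have "Re (of_real (1 - k) / w) = (1 - k) * Re w / (norm w)\<^sup>2"
    by (simp add: Re_divide cmod_power2)
  then show "Re (of_real k + of_real (1 - k) / w) > 0"
    using assms by (auto intro!: add_pos_nonneg divide_nonneg_nonneg simp del: of_real_diff)
  have "norm w \<ge> 1"
    using assms complex_Re_le_cmod[of w] by linarith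
  then have "norm (of_real (1 - k) / w) \<le> 1 - k"
    using assms mult_left_mono[of 1 "norm w" "1 - k"]
    by (simp add: norm_divide divide_le_eq del: of_real_diff)
  then show "norm (of_real k + of_real (1 - k) / w) \<le> 1"
    using norm_triangle_ineq[of "of_real k" "of_real (1 - k) / w"] assms by (simp del: of_real_diff)
  show "Im (of_real k + of_real (1 - k) / w) = - ((1 - k) * Im w / (norm w)\<^sup>2)"
    by (simp add: Im_divide cmod_power2 del: of_real_diff)
qed

lemma not_nonpos_Reals_if_Re_pos: "Re z > 0 \<Longrightarrow> z \<notin> \<real>\<^sub>\<le>\<^sub>0"
  by (auto simp: complex_nonpos_Reals_iff)


section \<open>The symbol \<open>M\<close> on the closed right half-plane\<close>

locale rod =
  fixes \<alpha> \<beta> a1 b1 a2 b2 :: real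
  assumes \<alpha>: "0 < \<alpha>" "\<alpha> < 1" and \<beta>: "0 < \<beta>"
    and a1: "0 < a1" and b: "0 < b1" "b1 < b2" and ratio: "a2 * b1 = a1 * b2"
    and cot_bound: "a1 > 2 * b1 * cosh (\<beta> * pi / 2) * sqrt (1 + (cot (\<alpha> * pi / 2) * tanh (\<beta> * pi / 2))\<^sup>2)"
    and tan_bound: "a1 > 2 * b1 * cosh (\<beta> * pi / 2) * sqrt (1 + (tan (\<alpha> * pi / 2) * tanh (\<beta> * pi / 2))\<^sup>2)"
begin

definition k :: real where "k = b1 / b2"
definition g :: "complex \<Rightarrow> complex" where "g = osc \<alpha> \<beta> (a1 / b1)"
definition w :: "complex \<Rightarrow> complex" where "w s = 1 + of_real b2 * g s"
definition N :: "complex \<Rightarrow> complex" where "N = M \<alpha> \<beta> a1 b1 a2 b2"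

lemma k: "0 < k" "k < 1"
  using b by (auto simp: k_def)

lemma Re_g: "Re s \<ge> 0 \<Longrightarrow> Re (g s) \<ge> 0"
  unfolding g_def using \<alpha> \<beta> b tan_bound by (intro Re_osc_nonneg) (auto simp: field_simps)

lemma Re_w: "Re s \<ge> 0 \<Longrightarrow> Re (w s) \<ge> 1"
  using Re_g[of s] b by (simp add: w_def)

lemma N_csqrt: "Re s \<ge> 0 \<Longrightarrow> N s = csqrt (of_real k + of_real (1 - k) / w s)"
  unfolding N_def k_def w_def g_def using b ratio Re_g[of s]
  by (intro M_eq_csqrt) (auto simp: g_def)

lemma N_squared: "Re s \<ge> 0 \<Longrightarrow> (N s)\<^sup>2 = of_real k + of_real (1 - k) / w s"
  using N_csqrt by simp

lemma norm_N_le: "Re s \<ge> 0 \<Longrightarrow> norm (N s) \<le> 1"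
  using Re_convex_recip_pos(2)[OF k Re_w[of s]] N_csqrt by simp

lemma Re_N_nonneg: "Re s \<ge> 0 \<Longrightarrow> Re (N s) \<ge> 0"
  using N_csqrt Re_csqrt by metis

text \<open>Neither the powers of \<open>s\<close> nor the square root meet their branch cuts.
  Admitting boundary points other than 0 in \<open>A\<close> yields continuity up to the imaginary
  axis together with holomorphy inside.\<close>

lemma N_holomorphic:
  assumes "A \<subseteq> {s. Re s \<ge> 0} - {0}"
  shows "N holomorphic_on A"
proof (rule holomorphic_transform)
  have A: "s \<notin> \<real>\<^sub>\<le>\<^sub>0" "Re s \<ge> 0" if "s \<in> A" for s
    using assms that by (auto simp: complex_nonpos_Reals_iff complex_eq_iff)
  have "w s \<noteq> 0" if "s \<in> A" for s
    using Re_w[OF A(2)[OF that]] by auto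
  moreover have "of_real k + of_real (1 - k) / w s \<notin> \<real>\<^sub>\<le>\<^sub>0" if "s \<in> A" for s
    by (intro not_nonpos_Reals_if_Re_pos Re_convex_recip_pos k Re_w A that)
  moreover have "w holomorphic_on A"
    unfolding w_def g_def osc_def using A by (intro holomorphic_intros) auto
  ultimately show "(\<lambda>s. csqrt (of_real k + of_real (1 - k) / w s)) holomorphic_on A"
    by (intro holomorphic_intros) auto
  show "csqrt (of_real k + of_real (1 - k) / w s) = N s" if "s \<in> A" for s
    using N_csqrt A that by simp
qed

lemma N_cnj:
  assumes "Re s \<ge> 0"
  shows "N (cnj s) = cnj (N s)"
proof -
  have "g (cnj s) = cnj (g s)"
    using assms by (simp add: g_def osc_def cnj_powr add.commute)
  then have "of_real k + of_real (1 - k) / w (cnj s) = cnj (of_real k + of_real (1 - k) / w s)"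
    by (simp add: w_def)
  moreover have "of_real k + of_real (1 - k) / w s \<notin> \<real>\<^sub>\<le>\<^sub>0"
    by (intro not_nonpos_Reals_if_Re_pos Re_convex_recip_pos k Re_w assms)
  note cnj_csqrt[OF this]
  ultimately show ?thesis
    using assms N_csqrt[of s] N_csqrt[of "cnj s"] by (simp only: cnj.sel)
qed

text \<open>Here \<open>- Im (N^2) = (1 - k) * b2 * Im g / |w|^2\<close> is at least of order
  \<open>|s|^(-\<alpha>)\<close>, because \<open>Im g\<close> is at least and \<open>|w|\<close> at
  most of order \<open>|s|^\<alpha>\<close>. Since \<open>0 < Re N \<le> 1\<close>, the same order
  bounds \<open>- Im N\<close> from below, and \<open>Re (s N) = Re s * Re N - Im s * Im N\<close>
  then grows like \<open>|Im s|^(1-\<alpha>)\<close>.\<close>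

lemma Re_mult_N_lower_bound_large:
  assumes "0 \<le> p"
  shows "\<exists>c>0. \<exists>R>0. \<forall>s. 0 \<le> Re s \<and> Re s \<le> p \<and> R \<le> \<bar>Im s\<bar> \<longrightarrow> c * \<bar>Im s\<bar> powr (1 - \<alpha>) \<le> Re (s * N s)"
proof -
  have "a1 / b1 > 2 * cosh (\<beta> * pi / 2) * sqrt (1 + (cot (\<alpha> * pi / 2) * tanh (\<beta> * pi / 2))\<^sup>2)"
    using cot_bound b by (simp add: field_simps)
  from Im_osc_lower_bound[OF \<alpha> less_imp_le[OF \<beta>] assms this]
  obtain c0 R0 where c0: "c0 > 0" and R0: "R0 > 0"
    and Im_g: "\<And>s. 0 \<le> Re s \<Longrightarrow> Re s \<le> p \<Longrightarrow> R0 \<le> Im s \<Longrightarrow> c0 * norm s powr \<alpha> \<le> Im (g s)"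
    unfolding g_def by blast
  define G where "G = a1 / b1 + 2 * exp (\<beta> * pi / 2)"
  define B where "B = 1 + b2 * G"
  define c1 where "c1 = (1 - k) * b2 * c0 / B\<^sup>2"
  \<comment> \<open>The 1 gives \<open>norm s powr \<alpha> \<ge> 1\<close>, which absorbs the
    constant term of \<open>w\<close>; the \<open>p\<close> gives
    \<open>norm s \<le> 2 * Im s\<close>.\<close>
  define R where "R = max R0 (max 1 p)"
  have "G > 0"
    using a1 b by (simp add: G_def add_pos_pos)
  then have B: "B > 0" "b2 * G > 0"
    using b by (simp_all add: B_def add_pos_pos)
  have c1: "c1 > 0"
    unfolding c1_def using k b c0 B by simp
  have upper: "c1 / 4 * Im s powr (1 - \<alpha>) \<le> Re (s * N s)"
    if s: "0 \<le> Re s" "Re s \<le> p" "R \<le> Im s" for s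
  proof -
    define P where "P = norm s powr \<alpha>"
    have "Im s \<ge> 1" "p \<le> Im s" "R0 \<le> Im s"
      using s by (auto simp: R_def)
    have norm_s: "norm s \<ge> Im s" "norm s \<le> 2 * Im s"
      using abs_Im_le_cmod[of s] cmod_le[of s] s \<open>Im s \<ge> 1\<close> \<open>p \<le> Im s\<close> by linarith+
    then have "norm s \<ge> 1" using \<open>Im s \<ge> 1\<close> by linarith
    then have P: "P \<ge> 1" unfolding P_def using \<alpha> by (simp add: ge_one_powr_ge_zero)
    have s0: "s \<noteq> 0" using \<open>norm s \<ge> 1\<close> by auto
    have "norm (g s) \<le> G * P"
      unfolding g_def G_def P_def using s s0 \<beta> a1 b by (intro norm_osc_le) auto
    then have "norm (w s) \<le> 1 + b2 * (G * P)"
      unfolding w_def using b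
      by (intro order.trans[OF norm_triangle_ineq]) (auto simp: norm_mult)
    also have "\<dots> \<le> B * P"
      using P by (simp add: B_def algebra_simps)
    finally have "norm (w s) \<le> B * P" .
    moreover have "norm (w s) \<ge> 1"
      using Re_w[OF s(1)] complex_Re_le_cmod[of "w s"] by linarith
    ultimately have sq: "(norm (w s))\<^sup>2 \<le> (B * P)\<^sup>2" "(norm (w s))\<^sup>2 > 0"
      by (auto intro: power_mono)
    have Imw: "Im (w s) \<ge> b2 * (c0 * P)"
      using Im_g[OF s(1,2) \<open>R0 \<le> Im s\<close>] b by (simp add: w_def P_def)
    have "c1 / P = (1 - k) * (b2 * (c0 * P)) / (B * P)\<^sup>2"
      using P by (simp add: c1_def power2_eq_square)
    also have "\<dots> \<le> (1 - k) * Im (w s) / (norm (w s))\<^sup>2"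
      using k b c0 P Imw sq by (intro frac_le mult_left_mono mult_nonneg_nonneg order.trans[OF _ Imw]) auto
    also have "\<dots> = - Im ((N s)\<^sup>2)"
      unfolding N_squared[OF s(1)] Re_convex_recip_pos(3)[OF k Re_w[OF s(1)]] by simp
    also have "\<dots> = Re (N s) * (2 * - Im (N s))"
      by (simp add: Im_power2)
    finally have *: "c1 / P \<le> Re (N s) * (2 * - Im (N s))" .
    have Re_N: "0 \<le> Re (N s)" "Re (N s) \<le> 1"
      using Re_N_nonneg[OF s(1)] norm_N_le[OF s(1)] complex_Re_le_cmod[of "N s"] by linarith+
    have "0 < c1 / P" using c1 P by simp
    with * have "0 < Re (N s) * (2 * - Im (N s))" by linarith
    with Re_N have "0 < - Im (N s)"
      by (simp add: mult_less_0_iff)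
    with Re_N have "Re (N s) * (2 * - Im (N s)) \<le> 2 * - Im (N s)"
      by (intro mult_left_le_one_le) auto
    with * have Im_N: "c1 / (2 * P) \<le> - Im (N s)"
      by simp
    have "c1 / 4 * Im s powr (1 - \<alpha>) \<le> c1 / 4 * norm s powr (1 - \<alpha>)"
      using c1 \<alpha> norm_s \<open>Im s \<ge> 1\<close> by (intro mult_left_mono powr_mono2) auto
    also have "\<dots> = norm s / 2 * (c1 / (2 * P))"
      using s0 by (simp add: P_def powr_diff)
    also have "\<dots> \<le> Im s * - Im (N s)"
      using Im_N norm_s \<open>Im s \<ge> 1\<close> c1 P by (intro mult_mono) auto
    also have "\<dots> \<le> Re (s * N s)"
      using s Re_N by simp
    finally show ?thesis .
  qed
  \<comment> \<open>The lower half of the strip follows by conjugation, which leaves the real part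
    of \<open>s * N s\<close> unchanged.\<close>
  have "c1 / 4 * \<bar>Im s\<bar> powr (1 - \<alpha>) \<le> Re (s * N s)"
    if s: "0 \<le> Re s" "Re s \<le> p" "R \<le> \<bar>Im s\<bar>" for s
  proof (cases "Im s \<ge> 0")
    case False
    with s upper[of "cnj s"] N_cnj[OF s(1)] show ?thesis by simp
  qed (use s upper[of s] in auto)
  moreover have "R > 0" by (simp add: R_def)
  ultimately show ?thesis
    using c1 by (intro exI[of _ "c1 / 4"] conjI exI[of _ R]) auto
qed

text \<open>Where \<open>Im s\<close> is small, \<open>norm (s * N s) \<le> norm s\<close> is
  bounded by \<open>p + R\<close>, which the constant \<open>C\<close> absorbs.\<close>

lemma Re_mult_N_lower_bound:
  assumes "0 \<le> p"
  shows "\<exists>c>0. \<exists>C. \<forall>s. 0 \<le> Re s \<and> Re s \<le> p \<longrightarrow> c * \<bar>Im s\<bar> powr (1 - \<alpha>) - C \<le> Re (s * N s)"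
proof -
  from Re_mult_N_lower_bound_large[OF assms] obtain c R where c: "c > 0" and R: "R > 0"
    and large: "\<And>s. 0 \<le> Re s \<Longrightarrow> Re s \<le> p \<Longrightarrow> R \<le> \<bar>Im s\<bar> \<Longrightarrow> c * \<bar>Im s\<bar> powr (1 - \<alpha>) \<le> Re (s * N s)"
    by blast
  have "c * \<bar>Im s\<bar> powr (1 - \<alpha>) - (c * R powr (1 - \<alpha>) + p + R) \<le> Re (s * N s)"
    if s: "0 \<le> Re s" "Re s \<le> p" for s
  proof (cases "R \<le> \<bar>Im s\<bar>")
    case True
    have "0 \<le> c * R powr (1 - \<alpha>)" using c by simp
    then show ?thesis using large[OF s True] assms R by linarith
  next
    case False
    then have "c * \<bar>Im s\<bar> powr (1 - \<alpha>) \<le> c * R powr (1 - \<alpha>)"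
      using c \<alpha> by (intro mult_left_mono powr_mono2) auto
    moreover have "norm (s * N s) \<le> norm s"
      unfolding norm_mult using norm_N_le[OF s(1)] by (simp add: mult_left_le)
    moreover have "norm s \<le> p + R"
      using cmod_le[of s] s False by linarith
    ultimately show ?thesis
      using abs_Re_le_cmod[of "s * N s"] by linarith
  qed
  with c show ?thesis
    by (intro exI[of _ c] conjI exI[of _ "c * R powr (1 - \<alpha>) + p + R"]) auto
qed

end

section \<open>Inverse Laplace integrals on the imaginary axis\<close>

lemma integrable_inverse_one_plus_square: "integrable lborel (\<lambda>x::real. inverse (1 + x\<^sup>2))"
  using integrable_inverse_1_plus_square by (simp add: set_integrable_def einterval_def)

text \<open>A stretched exponential decays faster than any power, so a multiple of
  \<open>1 / (1 + x^2)\<close> dominates it. The factor \<open>1 + X^2\<close> serves both beyond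
  \<open>X\<close>, where the product is below 1, and before it, where the exponential is at most
  1.\<close>

lemma integrable_exp_neg_powr:
  fixes k \<gamma> :: real
  assumes "0 < k" "0 < \<gamma>"
  shows "integrable lborel (\<lambda>x. exp (- (k * \<bar>x\<bar> powr \<gamma>)))"
proof -
  have "((\<lambda>x. exp (- (k * x powr \<gamma>)) * (1 + x\<^sup>2)) \<longlongrightarrow> 0) at_top"
    using assms by real_asymp
  then have "eventually (\<lambda>x. exp (- (k * x powr \<gamma>)) * (1 + x\<^sup>2) < 1) at_top"
    by (rule order_tendstoD) simp
  then obtain X where X: "\<And>x. x \<ge> X \<Longrightarrow> exp (- (k * x powr \<gamma>)) * (1 + x\<^sup>2) < 1"
    by (auto simp: eventually_at_top_linorder)
  have bound: "exp (- (k * \<bar>x\<bar> powr \<gamma>)) \<le> (1 + X\<^sup>2) * inverse (1 + x\<^sup>2)" for x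
  proof -
    have "exp (- (k * \<bar>x\<bar> powr \<gamma>)) * (1 + x\<^sup>2) \<le> 1 + X\<^sup>2"
    proof (cases "\<bar>x\<bar> \<ge> X")
      case True
      then show ?thesis using X[of "\<bar>x\<bar>"] by (simp add: add_increasing2 less_imp_le)
    next
      case False
      then have "x\<^sup>2 \<le> X\<^sup>2"
        by (intro abs_le_square_iff[THEN iffD1]) auto
      moreover have "exp (- (k * \<bar>x\<bar> powr \<gamma>)) \<le> 1"
        using assms by simp
      ultimately show ?thesis
        using mult_mono[of "exp (- (k * \<bar>x\<bar> powr \<gamma>))" 1 "1 + x\<^sup>2" "1 + X\<^sup>2"] by simp
    qed
    moreover have "1 + x\<^sup>2 > 0"
      by (simp add: add_pos_nonneg)
    ultimately show ?thesis
      by (simp add: field_simps)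
  qed
  show ?thesis
    by (rule Bochner_Integration.integrable_bound[OF integrable_mult_right[OF integrable_inverse_one_plus_square, of "1 + X\<^sup>2"]])
       (use bound in \<open>auto intro!: AE_I2\<close>)
qed

text \<open>Vertical contour segments produce gauge integrals over \<open>{-R..R}\<close>, while
  line integrals are Lebesgue integrals over the whole line. Dominated convergence with majorant
  \<open>norm (f x)\<close> connects the two.\<close>

lemma tendsto_integral_symmetric_interval:
  fixes f :: "real \<Rightarrow> 'a :: euclidean_space"
  assumes f: "integrable lborel f"
  shows "((\<lambda>R. integral {-R..R} f) \<longlongrightarrow> (LINT x|lborel. f x)) at_top"
proof -
  have "((\<lambda>R. LINT x|lborel. indicator {-R..R} x *\<^sub>R f x) \<longlongrightarrow> (LINT x|lborel. f x)) at_top"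
  proof (rule integral_dominated_convergence_at_top)
    show "integrable lborel (\<lambda>x. norm (f x))"
      using f by (rule integrable_norm)
    show "AE x in lborel. ((\<lambda>R. indicator {-R..R} x *\<^sub>R f x) \<longlongrightarrow> f x) at_top"
    proof (rule AE_I2)
      fix x :: real
      show "((\<lambda>R. indicator {-R..R} x *\<^sub>R f x) \<longlongrightarrow> f x) at_top"
        by (rule tendsto_eventually, rule eventually_mono[OF eventually_ge_at_top[of "\<bar>x\<bar>"]])
          (auto simp: indicator_def)
    qed
    show "\<forall>\<^sub>F R in at_top. AE x in lborel. norm (indicator {-R..R} x *\<^sub>R f x) \<le> norm (f x)"
      by (auto simp: indicator_def)
  qed (use f in auto)
  moreover have "set_integrable lborel {-R..R} f" for R
    unfolding set_integrable_def using f by (intro integrable_mult_indicator) auto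
  ultimately show ?thesis
    using set_borel_integral_eq_integral(2)[of _ f] by (simp add: set_lebesgue_integral_def)
qed

lemma integral_even:
  fixes u :: "real \<Rightarrow> real"
  assumes u: "integrable lborel u" and even: "\<And>x. u (- x) = u x"
  shows "(LINT x|lborel. u x) = 2 * (LINT x:{0..}|lborel. u x)"
proof -
  have int: "integrable lborel (\<lambda>x. indicator {0..} x * u x)" "integrable lborel (\<lambda>x. indicator {..0} x * u x)"
    using integrable_mult_indicator[OF _ u, of "{0..}"] integrable_mult_indicator[OF _ u, of "{..0}"] by auto
  have "(LINT x|lborel. u x) = (LINT x|lborel. indicator {0..} x * u x + indicator {..0} x * u x)"
    using u int AE_lborel_singleton[of "0::real"]
    by (intro integral_cong_AE) (auto elim!: eventually_mono simp: indicator_def)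
  also have "\<dots> = (LINT x:{0..}|lborel. u x) + (LINT x:{..0}|lborel. u x)"
    using int by (simp add: set_lebesgue_integral_def)
  also have "(LINT x:{..0}|lborel. u x) = (LINT x:{0..}|lborel. u x)"
  proof -
    have "{x::real. - x \<in> {..0}} = {0..}" by auto
    then show ?thesis
      using set_integral_reflect[of "{..0}" u] by (simp add: even)
  qed
  finally show ?thesis by simp
qed

text \<open>Reflection of the variable conjugates the integral, which is therefore real; the real
  part of the integrand is even.\<close>

lemma integral_conjugate_symmetric:
  fixes h :: "real \<Rightarrow> complex"
  assumes h: "integrable lborel h" and sym: "\<And>x. h (- x) = cnj (h x)"
  shows "(LINT x|lborel. h x) = of_real (2 * (LINT x:{0..}|lborel. Re (h x)))"
proof -
  have "(LINT x|lborel. h x) = (LINT x|lborel. h (- x))"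
    using lborel_integral_real_affine[of "-1" h 0] by simp
  also have "\<dots> = cnj (LINT x|lborel. h x)"
    by (simp add: sym)
  finally have "(LINT x|lborel. h x) = of_real (Re (LINT x|lborel. h x))"
    by (simp add: complex_eq_iff)
  also have "Re (LINT x|lborel. h x) = (LINT x|lborel. Re (h x))"
    using h by simp
  also have "\<dots> = 2 * (LINT x:{0..}|lborel. Re (h x))"
    using h by (intro integral_even) (auto simp: sym)
  finally show ?thesis .
qed

text \<open>What the contour shift uses of the symbol: regularity up to the boundary away from the
  branch point 0, conjugate symmetry, and growth of \<open>Re (s * N s)\<close> across the strip
  between the imaginary axis and the line \<open>Re s = p\<close>.\<close>

locale half_plane_symbol =
  fixes N :: "complex \<Rightarrow> complex" and \<gamma> p c C :: real
  assumes N_continuous: "continuous_on ({s. Re s \<ge> 0} - {0}) N"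
    and N_holomorphic: "N holomorphic_on {s. Re s > 0}"
    and norm_N_le: "\<And>s. Re s \<ge> 0 \<Longrightarrow> norm (N s) \<le> 1"
    and N_cnj: "\<And>s. Re s \<ge> 0 \<Longrightarrow> N (cnj s) = cnj (N s)"
    and pos: "0 < \<gamma>" "0 < p" "0 < c"
    and Re_mult_N: "\<And>s. 0 \<le> Re s \<Longrightarrow> Re s \<le> p \<Longrightarrow> c * \<bar>Im s\<bar> powr \<gamma> - C \<le> Re (s * N s)"
begin

definition F :: "real \<Rightarrow> real \<Rightarrow> complex \<Rightarrow> complex" where
  "F x t s = exp (of_real t * s) * exp (- s * N s * of_real x)"

text \<open>At 0, where continuity of \<open>N\<close> is not among the assumptions, the factor
  \<open>s\<close> and \<open>norm (N s) \<le> 1\<close> suffice.\<close>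

lemma mult_N_continuous: "continuous_on {s. Re s \<ge> 0} (\<lambda>s. s * N s)"
  unfolding continuous_on_eq_continuous_within
proof
  fix s assume s: "s \<in> {s. Re s \<ge> 0}"
  show "continuous (at s within {s. Re s \<ge> 0}) (\<lambda>s. s * N s)"
  proof (cases "s = 0")
    case True
    have "((\<lambda>s. s * N s) \<longlongrightarrow> 0) (at 0 within {s. Re s \<ge> 0})"
    proof (rule Lim_null_comparison)
      show "\<forall>\<^sub>F s in at 0 within {s. Re s \<ge> 0}. norm (s * N s) \<le> norm s"
        by (auto simp: eventually_at_filter norm_mult norm_N_le mult_left_le)
    qed (auto intro!: tendsto_eq_intros)
    with True show ?thesis by (simp add: continuous_within)
  next
    case False
    have "at s within {s. Re s \<ge> 0} = at s within ({s. Re s \<ge> 0} - {0})"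
      using False by (intro at_within_nhd[of _ "- {0}"]) auto
    moreover have "continuous (at s within ({s. Re s \<ge> 0} - {0})) N"
      using N_continuous s False by (auto simp: continuous_on_eq_continuous_within)
    ultimately show ?thesis
      by (auto intro!: continuous_intros)
  qed
qed

lemma F_continuous: "continuous_on {s. Re s \<ge> 0} (F x t)"
proof -
  have "continuous_on {s. Re s \<ge> 0} (\<lambda>s. exp (of_real t * s) * exp (- (s * N s) * of_real x))"
    by (intro continuous_intros mult_N_continuous)
  then show ?thesis by (simp add: F_def [abs_def])
qed

lemma F_holomorphic: "F x t holomorphic_on {s. Re s > 0}"
  unfolding F_def by (intro holomorphic_intros N_holomorphic)

lemma F_cnj: "Re s \<ge> 0 \<Longrightarrow> F x t (cnj s) = cnj (F x t s)"
  by (simp add: F_def N_cnj exp_cnj)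

text \<open>The growth bound is multiplied by \<open>x \<ge> 0\<close>, and
  \<open>exp (t * Re s)\<close> is at most \<open>exp (t * p)\<close>. The result depends on
  \<open>s\<close> only through \<open>\<bar>Im s\<bar>\<close>, hence holds uniformly across the
  strip.\<close>

lemma norm_F_le:
  assumes "0 \<le> Re s" "Re s \<le> p" "0 \<le> x" "0 \<le> t"
  shows "norm (F x t s) \<le> exp (t * p + C * x) * exp (- (c * x * \<bar>Im s\<bar> powr \<gamma>))"
proof -
  have "(c * \<bar>Im s\<bar> powr \<gamma> - C) * x \<le> Re (s * N s) * x"
    using Re_mult_N assms by (intro mult_right_mono) auto
  moreover have "t * Re s \<le> t * p"
    using assms by (intro mult_left_mono) auto
  moreover have "norm (F x t s) = exp (t * Re s - Re (s * N s) * x)"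
    unfolding F_def exp_add [symmetric] norm_exp_eq_Re by (simp add: algebra_simps)
  ultimately show ?thesis
    by (simp add: algebra_simps flip: exp_add)
qed

lemma F_line_continuous:
  assumes "0 \<le> q"
  shows "continuous_on A (\<lambda>\<tau>. F x t (Complex q \<tau>))"
proof -
  have "continuous_on A (\<lambda>\<tau>. F x t (of_real q + \<i> * of_real \<tau>))"
    using assms by (intro continuous_on_compose2[OF F_continuous] continuous_intros) auto
  then show ?thesis by (simp add: Complex_eq)
qed

lemma F_integrable:
  assumes "0 \<le> q" "q \<le> p" "0 < x" "0 \<le> t"
  shows "integrable lborel (\<lambda>\<tau>. F x t (Complex q \<tau>))"
proof (rule Bochner_Integration.integrable_bound)
  show "integrable lborel (\<lambda>\<tau>. exp (t * p + C * x) * exp (- (c * x * \<bar>\<tau>\<bar> powr \<gamma>)))"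
    using assms pos by (intro integrable_mult_right integrable_exp_neg_powr) auto
  show "(\<lambda>\<tau>. F x t (Complex q \<tau>)) \<in> borel_measurable lborel"
    using F_line_continuous[OF assms(1)] by (simp add: borel_measurable_continuous_onI)
  show "AE \<tau> in lborel. norm (F x t (Complex q \<tau>)) \<le> norm (exp (t * p + C * x) * exp (- (c * x * \<bar>\<tau>\<bar> powr \<gamma>)))"
    using norm_F_le[of "Complex q _" x t] assms by (intro AE_I2) auto
qed

text \<open>Cauchy's theorem on the rectangle with vertical sides on the two lines: the difference
  of the vertical integrals equals the contribution of the horizontal edges, each of length
  \<open>p\<close> at height \<open>R\<close> or \<open>- R\<close>.\<close>

lemma rectangle_bound:
  assumes "0 < R" "0 < x" "0 \<le> t"
  shows "norm (integral {-R..R} (\<lambda>\<tau>. F x t (Complex p \<tau>)) - integral {-R..R} (\<lambda>\<tau>. F x t (Complex 0 \<tau>)))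
    \<le> 2 * p * exp (t * p + C * x) * exp (- (c * x * R powr \<gamma>))"
proof -
  define B where "B = exp (t * p + C * x) * exp (- (c * x * R powr \<gamma>))"
  define z1 z2 z3 z4 where z: "z1 = Complex 0 (- R)" "z2 = Complex p (- R)" "z3 = Complex p R" "z4 = Complex 0 R"
  let ?S = "{s. Re s \<ge> 0}"
  have S: "convex ?S"
    by (rule convex_halfspace_Re_ge)
  have sub: "closed_segment z1 z2 \<subseteq> ?S" "closed_segment z2 z3 \<subseteq> ?S" "closed_segment z3 z4 \<subseteq> ?S" "closed_segment z4 z1 \<subseteq> ?S"
    by (intro closed_segment_subset S; use pos in \<open>simp add: z\<close>)+
  have "(F x t has_contour_integral 0) (linepath z1 z2 +++ linepath z2 z3 +++ linepath z3 z4 +++ linepath z4 z1)"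
  \<comment> \<open>The left side runs along the boundary of the half-plane and through the branch
    point 0. This form of the theorem asks for differentiability only in the interior, with
    continuity up to the boundary.\<close>
  proof (rule Cauchy_theorem_convex[where K = "{}" and S = ?S])
    fix s assume "s \<in> interior ?S - {}"
    then have "Re s > 0"
      using interior_halfspace_ge[of "1::complex" 0] by (simp add: inner_complex_def)
    then show "F x t field_differentiable at s"
      using F_holomorphic[of x t] by (intro holomorphic_on_imp_differentiable_at[of _ "{s. Re s > 0}"]) (auto simp: open_halfspace_Re_gt)
  qed (use S F_continuous sub in \<open>auto simp: path_image_join\<close>)
  then have sum0: "contour_integral (linepath z1 z2) (F x t) + contour_integral (linepath z2 z3) (F x t)
     + contour_integral (linepath z3 z4) (F x t) + contour_integral (linepath z4 z1) (F x t) = 0"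
    by (rule has_chain_integral_chain_integral4)
  have ci: "F x t contour_integrable_on linepath u v" if "closed_segment u v \<subseteq> ?S" for u v
    using that by (intro contour_integrable_continuous_linepath continuous_on_subset[OF F_continuous])
  have edge: "norm (contour_integral (linepath u v) (F x t)) \<le> B * p"
    if uv: "closed_segment u v \<subseteq> ?S" "norm (v - u) = p" "\<And>s. s \<in> closed_segment u v \<Longrightarrow> \<bar>Im s\<bar> = R \<and> Re s \<le> p" for u v
  proof -
    have "norm (contour_integral (linepath u v) (F x t)) \<le> B * norm (v - u)"
    proof (rule contour_integral_bound_linepath[OF ci[OF uv(1)]])
      show "norm (F x t s) \<le> B" if "s \<in> closed_segment u v" for s
        using norm_F_le[of s x t] uv(1) uv(3)[OF that] that assms by (auto simp: B_def)
    qed (simp add: B_def)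
    then show ?thesis using uv by simp
  qed
  have e1: "norm (contour_integral (linepath z1 z2) (F x t)) \<le> B * p"
    using sub pos assms by (intro edge) (auto simp: z closed_segment_same_Im cmod_def closed_segment_eq_real_ivl)
  have e3: "norm (contour_integral (linepath z3 z4) (F x t)) \<le> B * p"
    using sub pos assms by (intro edge) (auto simp: z closed_segment_same_Im cmod_def closed_segment_eq_real_ivl)
  have e2: "contour_integral (linepath z2 z3) (F x t) = \<i> * integral {-R..R} (\<lambda>\<tau>. F x t (Complex p \<tau>))"
    using assms by (intro contour_integral_linepath_same_Re) (auto simp: z)
  \<comment> \<open>The left side is traversed downwards; it is reversed so that the parametrisation
    by an increasing imaginary part applies.\<close>
  have "contour_integral (linepath z4 z1) (F x t) = - contour_integral (linepath z1 z4) (F x t)"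
    using contour_integral_reversepath[of "linepath z1 z4" "F x t"] by simp
  also have "contour_integral (linepath z1 z4) (F x t) = \<i> * integral {-R..R} (\<lambda>\<tau>. F x t (Complex 0 \<tau>))"
    using assms by (intro contour_integral_linepath_same_Re) (auto simp: z)
  finally have "\<i> * (integral {-R..R} (\<lambda>\<tau>. F x t (Complex p \<tau>)) - integral {-R..R} (\<lambda>\<tau>. F x t (Complex 0 \<tau>)))
      = - (contour_integral (linepath z1 z2) (F x t) + contour_integral (linepath z3 z4) (F x t))"
    using sum0 e2 by (simp add: algebra_simps)
  then have "norm (integral {-R..R} (\<lambda>\<tau>. F x t (Complex p \<tau>)) - integral {-R..R} (\<lambda>\<tau>. F x t (Complex 0 \<tau>)))
      = norm (contour_integral (linepath z1 z2) (F x t) + contour_integral (linepath z3 z4) (F x t))"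
    by (metis norm_minus_cancel norm_mult norm_ii mult_1)
  also have "\<dots> \<le> B * p + B * p"
    by (intro order.trans[OF norm_triangle_ineq] add_mono e1 e3)
  finally show ?thesis by (simp add: B_def algebra_simps)
qed

lemma shift_line:
  assumes "0 < x" "0 \<le> t"
  shows "(LINT \<tau>|lborel. F x t (Complex p \<tau>)) = (LINT \<tau>|lborel. F x t (Complex 0 \<tau>))"
proof -
  let ?D = "\<lambda>R. integral {-R..R} (\<lambda>\<tau>. F x t (Complex p \<tau>)) - integral {-R..R} (\<lambda>\<tau>. F x t (Complex 0 \<tau>))"
  have "(?D \<longlongrightarrow> (LINT \<tau>|lborel. F x t (Complex p \<tau>)) - (LINT \<tau>|lborel. F x t (Complex 0 \<tau>))) at_top"
    using assms pos by (intro tendsto_diff tendsto_integral_symmetric_interval F_integrable) auto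
  moreover have "(?D \<longlongrightarrow> 0) at_top"
  proof (rule Lim_null_comparison)
    show "\<forall>\<^sub>F R in at_top. norm (?D R) \<le> 2 * p * exp (t * p + C * x) * exp (- (c * x * R powr \<gamma>))"
      using eventually_gt_at_top[of 0] by eventually_elim (use assms in \<open>auto intro!: rectangle_bound\<close>)
    have "((\<lambda>R. exp (- (k * R powr \<gamma>))) \<longlongrightarrow> 0) at_top" if "0 < k" for k
      using that pos(1) by real_asymp
    from this[of "c * x"] assms pos
    have "((\<lambda>R. exp (- (c * x * R powr \<gamma>))) \<longlongrightarrow> 0) at_top"
      by simp
    then show "((\<lambda>R. 2 * p * exp (t * p + C * x) * exp (- (c * x * R powr \<gamma>))) \<longlongrightarrow> 0) at_top"
      by (rule tendsto_mult_right_zero)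
  qed
  ultimately have "(LINT \<tau>|lborel. F x t (Complex p \<tau>)) - (LINT \<tau>|lborel. F x t (Complex 0 \<tau>)) = 0"
    by (rule tendsto_unique[rotated]) simp
  then show ?thesis by simp
qed

text \<open>Dominated convergence on \<open>{a/2<..<2*a}\<close>: the lower end preserves a fixed
  rate of decay, the upper end limits the factor \<open>exp (C * x)\<close>. The majorant takes
  \<open>\<bar>C\<bar>\<close> because the sign of \<open>C\<close> is unknown.\<close>

lemma imaginary_axis_integral_continuous:
  assumes "0 \<le> t"
  shows "continuous_on {0<..} (\<lambda>x. LINT \<tau>|lborel. F x t (Complex 0 \<tau>))"
proof (intro continuous_at_imp_continuous_on ballI)
  fix a :: real assume "a \<in> {0<..}"
  then have a: "a > 0" by simp
  have "continuous_on {a/2<..<2*a} (\<lambda>x. LINT \<tau>|lborel. F x t (Complex 0 \<tau>))"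
    unfolding continuous_on_sequentially comp_def
  proof (safe, rule integral_dominated_convergence)
    fix X :: "nat \<Rightarrow> real" and y assume y: "y \<in> {a/2<..<2*a}" and X: "\<forall>n. X n \<in> {a/2<..<2*a}" "X \<longlonglongrightarrow> y"
    let ?w = "\<lambda>\<tau>. exp (t * p + \<bar>C\<bar> * (2 * a)) * exp (- (c * (a / 2) * \<bar>\<tau>\<bar> powr \<gamma>))"
    show "integrable lborel ?w"
      using a pos by (intro integrable_mult_right integrable_exp_neg_powr) auto
    show "(\<lambda>\<tau>. F y t (Complex 0 \<tau>)) \<in> borel_measurable lborel"
      "\<And>n. (\<lambda>\<tau>. F (X n) t (Complex 0 \<tau>)) \<in> borel_measurable lborel"
      using F_line_continuous[of 0] by (simp_all add: borel_measurable_continuous_onI)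
    show "AE \<tau> in lborel. (\<lambda>n. F (X n) t (Complex 0 \<tau>)) \<longlonglongrightarrow> F y t (Complex 0 \<tau>)"
      unfolding F_def by (intro AE_I2 tendsto_intros X)
    fix n
    have n: "a / 2 < X n" "X n < 2 * a" using X by auto
    show "AE \<tau> in lborel. norm (F (X n) t (Complex 0 \<tau>)) \<le> ?w \<tau>"
    proof (rule AE_I2)
      fix \<tau>
      have "norm (F (X n) t (Complex 0 \<tau>)) \<le> exp (t * p + C * X n) * exp (- (c * X n * \<bar>\<tau>\<bar> powr \<gamma>))"
        using norm_F_le[of "Complex 0 \<tau>" "X n" t] pos assms a n by simp
      moreover have "C * X n \<le> \<bar>C\<bar> * (2 * a)"
        using n a by (intro mult_mono) auto
      then have "exp (t * p + C * X n) \<le> exp (t * p + \<bar>C\<bar> * (2 * a))" by simp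
      moreover have "c * (a / 2) * \<bar>\<tau>\<bar> powr \<gamma> \<le> c * X n * \<bar>\<tau>\<bar> powr \<gamma>"
        using n pos by (intro mult_right_mono mult_left_mono) auto
      ultimately show "norm (F (X n) t (Complex 0 \<tau>)) \<le> ?w \<tau>"
        by (elim order.trans, intro mult_mono) auto
    qed
  qed
  then show "isCont (\<lambda>x. LINT \<tau>|lborel. F x t (Complex 0 \<tau>)) a"
    using a by (intro continuous_on_interior) auto
qed

lemma Re_F_imaginary_axis:
  "Re (F x t (Complex 0 \<tau>)) = exp (\<tau> * Im (N (\<i> * of_real \<tau>)) * x) * cos (\<tau> * (t - Re (N (\<i> * of_real \<tau>)) * x))"
proof -
  have "Complex 0 \<tau> = \<i> * of_real \<tau>"
    by (simp add: complex_eq_iff)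
  then show ?thesis
    unfolding F_def exp_add [symmetric] by (simp add: Re_exp algebra_simps)
qed

text \<open>After the shift to the imaginary axis, conjugate symmetry folds the integral onto the
  positive half-line. The resulting factor 2 turns \<open>1 / (2 * pi)\<close> into
  \<open>1 / pi\<close>.\<close>

lemma inverse_laplace_formula:
  assumes "0 < x" "0 \<le> t"
  shows "set_integrable lborel {0..} (\<lambda>\<tau>. exp (\<tau> * Im (N (\<i> * of_real \<tau>)) * x)
           * cos (\<tau> * (t - Re (N (\<i> * of_real \<tau>)) * x)))"
    and "inv_laplace p (\<lambda>s. exp (- s * N s * of_real x)) t = of_real (1 / pi *
           (LINT \<tau>:{0..}|lborel. exp (\<tau> * Im (N (\<i> * of_real \<tau>)) * x)
           * cos (\<tau> * (t - Re (N (\<i> * of_real \<tau>)) * x))))"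
proof -
  have int: "integrable lborel (\<lambda>\<tau>. F x t (Complex 0 \<tau>))"
    using assms pos by (intro F_integrable) auto
  then have "integrable lborel (\<lambda>\<tau>. Re (F x t (Complex 0 \<tau>)))"
    by simp
  then show "set_integrable lborel {0..} (\<lambda>\<tau>. exp (\<tau> * Im (N (\<i> * of_real \<tau>)) * x)
           * cos (\<tau> * (t - Re (N (\<i> * of_real \<tau>)) * x)))"
    unfolding set_integrable_def Re_F_imaginary_axis by (intro integrable_mult_indicator) auto
  have "F x t (Complex 0 (- \<tau>)) = cnj (F x t (Complex 0 \<tau>))" for \<tau>
    using F_cnj[of "Complex 0 \<tau>" x t] by (simp add: complex_cnj)
  from integral_conjugate_symmetric[OF int this]
  show "inv_laplace p (\<lambda>s. exp (- s * N s * of_real x)) t = of_real (1 / pi *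
           (LINT \<tau>:{0..}|lborel. exp (\<tau> * Im (N (\<i> * of_real \<tau>)) * x)
           * cos (\<tau> * (t - Re (N (\<i> * of_real \<tau>)) * x))))"
    using shift_line[OF assms]
    unfolding inv_laplace_def line_integral_def F_def [symmetric] Re_F_imaginary_axis [symmetric] by simp
qed

lemma inv_laplace_eq:
  assumes "0 < x" "0 \<le> t"
  shows "inv_laplace p (\<lambda>s. exp (- s * N s * of_real x)) t
    = 1 / (2 * of_real pi) * (LINT \<tau>|lborel. F x t (Complex 0 \<tau>))"
  using shift_line[OF assms] unfolding inv_laplace_def line_integral_def F_def [symmetric] by simp

lemma inv_laplace_line_integrable:
  assumes "0 < x" "0 \<le> t"
  shows "line_integrable p (\<lambda>s. exp (of_real t * s) * exp (- s * N s * of_real x))"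
  using F_integrable[of p x t] assms pos unfolding line_integrable_def F_def [symmetric] by simp

lemma inv_laplace_continuous:
  assumes "0 \<le> t"
  shows "continuous_on {0<..} (\<lambda>x. inv_laplace p (\<lambda>s. exp (- s * N s * of_real x)) t)"
proof -
  have "continuous_on {0<..} (\<lambda>x. 1 / (2 * of_real pi) * (LINT \<tau>|lborel. F x t (Complex 0 \<tau>)))"
    by (intro continuous_intros imaginary_axis_integral_continuous assms)
  then show ?thesis
    by (rule continuous_on_eq) (simp only: inv_laplace_eq assms greaterThan_iff)
qed

end

section \<open>Fourier inversion at a point\<close>

lemma integrable_compact_support:
  fixes h :: "real \<Rightarrow> complex"
  assumes "continuous_on UNIV h" "\<And>t. B < \<bar>t\<bar> \<Longrightarrow> h t = 0"
  shows "integrable lborel h"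
proof -
  have "set_integrable lborel {-B..B} h"
    using assms(1) by (intro borel_integrable_atLeastAtMost') (auto intro: continuous_on_subset)
  moreover have "(\<lambda>t. indicator {-B..B} t *\<^sub>R h t) = h"
    using assms(2) by (force simp: indicator_def)
  ultimately show ?thesis by (simp add: set_integrable_def)
qed

lemma integral_derivative_compact_support:
  fixes h :: "real \<Rightarrow> complex"
  assumes "\<And>t. (h has_vector_derivative h' t) (at t)" "continuous_on UNIV h'"
    and "\<And>t. B < \<bar>t\<bar> \<Longrightarrow> h t = 0" "\<And>t. B < \<bar>t\<bar> \<Longrightarrow> h' t = 0"
  shows "(LINT t|lborel. h' t) = 0"
proof -
  \<comment> \<open>Positive and strictly beyond the support, so that both boundary terms
    vanish.\<close>
  define b where "b = \<bar>B\<bar> + 1"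
  have "(LINT t|lborel. indicator {-b..b} t *\<^sub>R h' t) = h b - h (- b)"
    using assms(2) by (intro integral_FTC_atLeastAtMost)
      (auto simp: b_def intro: has_vector_derivative_at_within assms(1) continuous_on_subset)
  moreover have "(\<lambda>t. indicator {-b..b} t *\<^sub>R h' t) = h'"
    using assms(4) by (force simp: indicator_def b_def)
  ultimately show ?thesis using assms(3) by (simp add: b_def)
qed

text \<open>The weak form of the fact that the derivative of \<open>sgn\<close> is twice the Dirac
  distribution: the fundamental theorem on each side of 0 leaves only the value at 0.\<close>

lemma integral_sgn_derivative:
  fixes h :: "real \<Rightarrow> complex"
  assumes "\<And>t. (h has_vector_derivative h' t) (at t)" "continuous_on UNIV h'"
    and "\<And>t. B < \<bar>t\<bar> \<Longrightarrow> h t = 0" "\<And>t. B < \<bar>t\<bar> \<Longrightarrow> h' t = 0"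
  shows "(LINT t|lborel. sgn t *\<^sub>R h' t) = - 2 * h 0"
proof -
  define b where "b = \<bar>B\<bar> + 1"
  have "(LINT t|lborel. indicator {0..b} t *\<^sub>R h' t) = h b - h 0"
    using assms(2) by (intro integral_FTC_atLeastAtMost)
      (auto simp: b_def intro: has_vector_derivative_at_within assms(1) continuous_on_subset)
  moreover have "(LINT t|lborel. indicator {-b..0} t *\<^sub>R h' t) = h 0 - h (- b)"
    using assms(2) by (intro integral_FTC_atLeastAtMost)
      (auto simp: b_def intro: has_vector_derivative_at_within assms(1) continuous_on_subset)
  \<comment> \<open>At \<open>t = 0\<close> both indicators are 1 and cancel, in accordance with
    \<open>sgn 0 = 0\<close>.\<close>
  moreover have "sgn t *\<^sub>R h' t = indicator {0..b} t *\<^sub>R h' t - indicator {-b..0} t *\<^sub>R h' t" for t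
    using assms(4)[of t] by (force simp: indicator_def b_def sgn_if)
  moreover have "integrable lborel (\<lambda>t. indicator A t *\<^sub>R h' t)" if "A \<in> sets borel" for A
    using that integrable_compact_support[OF assms(2,4)] by (intro integrable_mult_indicator) auto
  ultimately show ?thesis using assms(3) by (simp add: b_def)
qed

text \<open>The Dirichlet kernel \<open>2 * sin (R * t) / t\<close>, with \<open>sinc\<close>
  supplying its value at \<open>t = 0\<close>.\<close>

lemma integral_exp_symmetric:
  assumes "R \<ge> 0"
  shows "integral {-R..R} (\<lambda>\<tau>. exp (\<i> * of_real (\<tau> * t))) = of_real (2 * R * sinc (R * t))"
proof (cases "R = 0 \<or> t = 0")
  case False
  have "((\<lambda>\<tau>. exp (\<i> * of_real (\<tau> * t))) has_integral
      exp (\<i> * of_real (R * t)) / (\<i> * of_real t) - exp (\<i> * of_real (- R * t)) / (\<i> * of_real t)) {-R..R}"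
    using assms False
    by (intro fundamental_theorem_of_calculus)
      (auto intro!: derivative_eq_intros has_vector_derivative_real_field simp: mult.commute[of _ \<i>])
  moreover have "exp (\<i> * of_real (R * t)) / (\<i> * of_real t) - exp (\<i> * of_real (- R * t)) / (\<i> * of_real t)
      = of_real (2 * R * sinc (R * t))"
    using False by (simp add: complex_eq_iff Re_divide Im_divide Re_exp Im_exp power2_eq_square)
  ultimately show ?thesis by (simp add: integral_unique)
qed (use assms in \<open>auto simp: scaleR_conv_of_real\<close>)

lemma Si_tendsto_sgn: "((\<lambda>R. Si (R * t)) \<longlongrightarrow> pi / 2 * sgn t) at_top"
proof -
  have pos: "((\<lambda>R. Si (R * u)) \<longlongrightarrow> pi / 2) at_top" if "u > 0" for u
    using that by (intro filterlim_compose[OF Si_at_top] filterlim_at_top_mult_tendsto_pos[OF tendsto_const] filterlim_ident)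
  consider "t > 0" | "t = 0" | "t < 0" by linarith
  then show ?thesis
  proof cases
    case 3
    have "((\<lambda>R. - Si (R * - t)) \<longlongrightarrow> - (pi / 2)) at_top"
      using 3 by (intro tendsto_minus pos) auto
    moreover have "\<forall>\<^sub>F R in at_top. - Si (R * - t) = Si (R * t)"
      using eventually_ge_at_top[of 0]
    proof eventually_elim
      case (elim R)
      with 3 show ?case using Si_neg[of "R * - t"] by (simp add: mult_nonneg_nonpos)
    qed
    ultimately show ?thesis
      using 3 by (simp add: tendsto_cong)
  qed (use pos Si_neg[of 0] in auto)
qed

text \<open>The Dirichlet kernels have no common integrable majorant near 0, but their
  antiderivatives \<open>2 * Si (R * t)\<close> are uniformly bounded. One integration by parts
  therefore makes dominated convergence available. Integrability of the transform identifies the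
  limit over symmetric intervals with the full integral.\<close>

lemma fourier_inversion_at_zero:
  fixes \<psi> \<psi>' :: "real \<Rightarrow> complex"
  assumes deriv: "\<And>t. (\<psi> has_vector_derivative \<psi>' t) (at t)" and cont: "continuous_on UNIV \<psi>'"
    and zero: "\<And>t. B < \<bar>t\<bar> \<Longrightarrow> \<psi> t = 0" "\<And>t. B < \<bar>t\<bar> \<Longrightarrow> \<psi>' t = 0"
    and int: "integrable lborel (\<lambda>\<tau>. LINT t|lborel. exp (\<i> * of_real (\<tau> * t)) * \<psi> t)"
  shows "(LINT \<tau>|lborel. LINT t|lborel. exp (\<i> * of_real (\<tau> * t)) * \<psi> t) = 2 * of_real pi * \<psi> 0"
proof -
  have \<psi>_cont: "continuous_on A \<psi>" for A
    using deriv by (meson continuous_at_imp_continuous_on has_vector_derivative_continuous)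
  \<comment> \<open>Passing to a compact interval allows the order of integration to be exchanged by
    continuity on a rectangle.\<close>
  have restrict: "(LINT t|lborel. f t * \<psi> t) = integral {-B..B} (\<lambda>t. f t * \<psi> t)"
    if "continuous_on UNIV f" for f
  proof -
    have "set_integrable lborel {-B..B} (\<lambda>t. f t * \<psi> t)"
      using \<psi>_cont that by (intro borel_integrable_atLeastAtMost' continuous_intros) (auto intro: continuous_on_subset)
    moreover have "(\<lambda>t. indicator {-B..B} t *\<^sub>R (f t * \<psi> t)) = (\<lambda>t. f t * \<psi> t)"
      using zero(1) by (force simp: indicator_def)
    ultimately show ?thesis
      using set_borel_integral_eq_integral(2)[of "{-B..B}" "\<lambda>t. f t * \<psi> t"]
      by (simp add: set_lebesgue_integral_def)
  qed
  have partial: "integral {-R..R} (\<lambda>\<tau>. LINT t|lborel. exp (\<i> * of_real (\<tau> * t)) * \<psi> t)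
      = - 2 * (LINT t|lborel. Si (R * t) *\<^sub>R \<psi>' t)" if R: "R \<ge> 0" for R
  proof -
    have "integral {-R..R} (\<lambda>\<tau>. LINT t|lborel. exp (\<i> * of_real (\<tau> * t)) * \<psi> t)
        = integral {-R..R} (\<lambda>\<tau>. integral {-B..B} (\<lambda>t. exp (\<i> * of_real (\<tau> * t)) * \<psi> t))"
      by (intro integral_cong restrict continuous_intros)
    also have "\<dots> = integral {-B..B} (\<lambda>t. integral {-R..R} (\<lambda>\<tau>. exp (\<i> * of_real (\<tau> * t)) * \<psi> t))"
      unfolding box_real [symmetric]
      by (intro integral_swap_continuous)
        (auto simp: case_prod_unfold intro!: continuous_intros continuous_on_compose2[OF \<psi>_cont[of UNIV]])
    also have "\<dots> = integral {-B..B} (\<lambda>t. of_real (2 * R * sinc (R * t)) * \<psi> t)"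
      by (simp only: integral_mult_left integral_exp_symmetric[OF R])
    also have "\<dots> = (LINT t|lborel. of_real (2 * R * sinc (R * t)) * \<psi> t)"
      by (intro restrict[symmetric] continuous_intros)
    also have "\<dots> = - (LINT t|lborel. of_real (2 * Si (R * t)) * \<psi>' t)"
    proof -
      let ?f = "\<lambda>t. of_real (2 * R * sinc (R * t)) * \<psi> t" and ?g = "\<lambda>t. of_real (2 * Si (R * t)) * \<psi>' t"
      have Si_cont: "continuous_on UNIV (\<lambda>t. Si (R * t))"
        by (intro continuous_at_imp_continuous_on ballI isCont_o2[OF _ isCont_Si]) simp
      have "continuous_on UNIV ?f"
        by (intro continuous_intros \<psi>_cont)
      then have f: "continuous_on UNIV ?f" "\<And>t. B < \<bar>t\<bar> \<Longrightarrow> ?f t = 0"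
        using zero by simp_all
      have "continuous_on UNIV ?g"
        by (intro continuous_intros Si_cont cont)
      then have g: "continuous_on UNIV ?g" "\<And>t. B < \<bar>t\<bar> \<Longrightarrow> ?g t = 0"
        using zero by simp_all
      \<comment> \<open>Product rule: \<open>?f + ?g\<close> is the derivative of a compactly
        supported function, so its integral is 0.\<close>
      have "((\<lambda>t. of_real (2 * Si (R * t)) * \<psi> t) has_vector_derivative ?f t + ?g t) (at t)" for t
      proof -
        have "((\<lambda>t. Si (R * t)) has_real_derivative sinc (R * t) * R) (at t)"
          by (rule DERIV_chain'[where g = Si, OF _ DERIV_Si]) (auto intro!: derivative_eq_intros)
        then have "((\<lambda>t. 2 * Si (R * t)) has_real_derivative 2 * R * sinc (R * t)) (at t)"
          by (auto dest: DERIV_cmult[where c = 2] simp: mult_ac)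
        then have "((\<lambda>t. complex_of_real (2 * Si (R * t))) has_vector_derivative of_real (2 * R * sinc (R * t))) (at t)"
          by (intro has_vector_derivative_of_real) (simp add: has_real_derivative_iff_has_vector_derivative)
        from has_vector_derivative_mult[OF this deriv] show ?thesis
          by (simp only: add.commute)
      qed
      then have "(LINT t|lborel. ?f t + ?g t) = 0"
      proof (rule integral_derivative_compact_support[where B = B])
        show "continuous_on UNIV (\<lambda>t. ?f t + ?g t)"
          by (rule continuous_on_add[OF f(1) g(1)])
        show "?f t + ?g t = 0" if "B < \<bar>t\<bar>" for t
          using f(2)[OF that] g(2)[OF that] by (simp only: add_0)
      qed (use zero in simp_all)
      then have "(LINT t|lborel. ?f t) + (LINT t|lborel. ?g t) = 0"
        using integrable_compact_support[OF f] integrable_compact_support[OF g] by simp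
      then show ?thesis by (simp only: add_eq_0_iff2)
    qed
    also have "(\<lambda>t. of_real (2 * Si (R * t)) * \<psi>' t) = (\<lambda>t. 2 * (Si (R * t) *\<^sub>R \<psi>' t))"
      by (simp add: scaleR_conv_of_real mult.assoc)
    finally show ?thesis by (simp only: integral_mult_right_zero mult_minus_left)
  qed
  obtain A where A: "\<And>T. \<bar>Si T\<bar> \<le> A"
    using bounded_Si by blast
  have "((\<lambda>R. LINT t|lborel. Si (R * t) *\<^sub>R \<psi>' t) \<longlongrightarrow> (LINT t|lborel. (pi / 2 * sgn t) *\<^sub>R \<psi>' t)) at_top"
  proof (rule integral_dominated_convergence_at_top)
    have \<psi>'[measurable]: "\<psi>' \<in> borel_measurable borel"
      using cont by (rule borel_measurable_continuous_onI)
    show "(\<lambda>t. (pi / 2 * sgn t) *\<^sub>R \<psi>' t) \<in> borel_measurable lborel"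
      "\<And>R. (\<lambda>t. Si (R * t) *\<^sub>R \<psi>' t) \<in> borel_measurable lborel"
      by measurable
    show "integrable lborel (\<lambda>t. A * norm (\<psi>' t))"
      by (intro integrable_mult_right integrable_norm integrable_compact_support[OF cont zero(2)])
    show "AE t in lborel. ((\<lambda>R. Si (R * t) *\<^sub>R \<psi>' t) \<longlongrightarrow> (pi / 2 * sgn t) *\<^sub>R \<psi>' t) at_top"
      by (intro AE_I2 tendsto_scaleR Si_tendsto_sgn tendsto_const)
    show "\<forall>\<^sub>F R in at_top. AE t in lborel. norm (Si (R * t) *\<^sub>R \<psi>' t) \<le> A * norm (\<psi>' t)"
      unfolding norm_scaleR real_norm_def by (intro always_eventually allI AE_I2 mult_right_mono A norm_ge_zero)
  qed
  then have "((\<lambda>R. - 2 * (LINT t|lborel. Si (R * t) *\<^sub>R \<psi>' t)) \<longlongrightarrow> - 2 * (LINT t|lborel. (pi / 2 * sgn t) *\<^sub>R \<psi>' t)) at_top"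
    by (intro tendsto_intros)
  moreover have "- 2 * (LINT t|lborel. (pi / 2 * sgn t) *\<^sub>R \<psi>' t) = 2 * of_real pi * \<psi> 0"
    using integral_sgn_derivative[OF deriv cont zero] by (simp add: scaleR_conv_of_real mult.assoc flip: scaleR_scaleR)
  ultimately have "((\<lambda>R. - 2 * (LINT t|lborel. Si (R * t) *\<^sub>R \<psi>' t)) \<longlongrightarrow> 2 * of_real pi * \<psi> 0) at_top"
    by (simp only:)
  then have "((\<lambda>R. integral {-R..R} (\<lambda>\<tau>. LINT t|lborel. exp (\<i> * of_real (\<tau> * t)) * \<psi> t)) \<longlongrightarrow> 2 * of_real pi * \<psi> 0) at_top"
    by (rule Lim_transform_eventually) (rule eventually_mono[OF eventually_ge_at_top[of 0]], rule partial[symmetric])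
  with tendsto_integral_symmetric_interval[OF int] show ?thesis
    by (intro tendsto_unique[of at_top]) auto
qed

section \<open>Test functions and the inverse transform of 1\<close>

lemma test_function_derivatives_vanish:
  assumes "\<And>n t. (D n has_vector_derivative D (Suc n) t) (at t)" "\<And>t. B < \<bar>t\<bar> \<Longrightarrow> D 0 t = (0::complex)"
  shows "B < \<bar>t\<bar> \<Longrightarrow> D n t = 0"
proof (induction n arbitrary: t)
  case (Suc n)
  have "open {t::real. B < \<bar>t\<bar>}"
    by (intro open_Collect_less continuous_intros)
  then have "((\<lambda>_. 0) has_vector_derivative D (Suc n) t) (at t)"
    using Suc by (intro has_vector_derivative_transform_within_open[OF assms(1)]) auto
  then show ?case
    using vector_derivative_unique_at has_vector_derivative_const by blast
qed (use assms in simp)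

lemma test_functionE:
  assumes "test_function \<phi>"
  obtains D B where "D 0 = \<phi>" "\<And>n t. (D n has_vector_derivative D (Suc n) t) (at t)"
    "\<And>n t. B < \<bar>t\<bar> \<Longrightarrow> D n t = 0" "\<And>n A. continuous_on A (D n)"
proof -
  from assms obtain D where D: "D 0 = \<phi>" "\<And>n t. (D n has_vector_derivative D (Suc n) t) (at t)"
    and "compact (closure {t. \<phi> t \<noteq> 0})"
    unfolding test_function_def by blast
  then obtain B where "\<And>t. t \<in> closure {t. \<phi> t \<noteq> 0} \<Longrightarrow> \<bar>t\<bar> \<le> B"
    using compact_imp_bounded bounded_real by metis
  then have zero: "D 0 t = 0" if "B < \<bar>t\<bar>" for t
    using that closure_subset[of "{t. \<phi> t \<noteq> 0}"] D(1) by force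
  have "D n t = 0" if "B < \<bar>t\<bar>" for n t
    by (rule test_function_derivatives_vanish[where D = D and B = B]) (fact D(2) zero that)+
  moreover have "continuous_on A (D n)" for n A
    using D(2) by (meson continuous_at_imp_continuous_on has_vector_derivative_continuous)
  ultimately show ?thesis
    using D that by blast
qed

text \<open>Integration by parts without boundary terms. Each derivative of the test function gains
  a factor \<open>s\<close>, which is the source of decay along vertical lines.\<close>

lemma exp_distr_derivative:
  assumes "\<And>t. (\<phi> has_vector_derivative \<phi>' t) (at t)" "continuous_on UNIV \<phi>'"
    and "\<And>t. B < \<bar>t\<bar> \<Longrightarrow> \<phi> t = 0" "\<And>t. B < \<bar>t\<bar> \<Longrightarrow> \<phi>' t = 0"
  shows "exp_distr s \<phi>' = - s * exp_distr s \<phi>"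
proof -
  let ?f = "\<lambda>t. s * (exp (of_real t * s) * \<phi> t)" and ?g = "\<lambda>t. exp (of_real t * s) * \<phi>' t"
  have \<phi>: "continuous_on UNIV \<phi>"
    using assms(1) by (meson continuous_at_imp_continuous_on has_vector_derivative_continuous)
  have cont: "continuous_on UNIV ?f" "continuous_on UNIV ?g"
    by (intro continuous_intros \<phi> assms(2))+
  have "((\<lambda>t. exp (of_real t * s)) has_vector_derivative s * exp (of_real t * s)) (at t)" for t :: real
    by (rule has_vector_derivative_real_field) (auto intro!: derivative_eq_intros)
  from has_vector_derivative_mult[OF this assms(1)]
  have "((\<lambda>t. exp (of_real t * s) * \<phi> t) has_vector_derivative ?f t + ?g t) (at t)" for t
    by (simp add: add.commute mult.assoc)
  then have "(LINT t|lborel. ?f t + ?g t) = 0"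
  proof (rule integral_derivative_compact_support[where B = B])
    show "continuous_on UNIV (\<lambda>t. ?f t + ?g t)"
      by (rule continuous_on_add[OF cont])
  qed (use assms in simp_all)
  moreover have "integrable lborel ?f" "integrable lborel ?g"
    using assms(3,4) by (auto intro!: integrable_compact_support[OF cont(1), of B] integrable_compact_support[OF cont(2), of B])
  ultimately have "s * exp_distr s \<phi> + exp_distr s \<phi>' = 0"
    unfolding exp_distr_def by (simp add: Bochner_Integration.integral_add)
  then show ?thesis by (simp add: add_eq_0_iff2)
qed

lemma norm_exp_distr_le: "norm (exp_distr s \<phi>) \<le> (LINT t|lborel. exp (t * Re s) * norm (\<phi> t))"
  unfolding exp_distr_def by (rule order.trans[OF integral_norm_bound]) (simp add: norm_mult)

text \<open>Two derivatives give the bound \<open>A 2\<close> for \<open>\<tau>^2\<close> times the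
  transform, and none gives \<open>A 0\<close> for the transform itself. Their sum yields a majorant
  of order \<open>1 / (1 + \<tau>^2)\<close>.\<close>

lemma exp_distr_integrable_on_line:
  assumes "test_function \<phi>"
  shows "integrable lborel (\<lambda>\<tau>. exp_distr (Complex p \<tau>) \<phi>)"
proof -
  obtain D B where D: "D 0 = \<phi>" "\<And>n t. (D n has_vector_derivative D (Suc n) t) (at t)"
    "\<And>n t. B < \<bar>t\<bar> \<Longrightarrow> D n t = 0" "\<And>n A. continuous_on A (D n)"
    using test_functionE[OF assms] by metis
  have "exp_distr s (D (Suc n)) = - s * exp_distr s (D n)" for s n
    by (rule exp_distr_derivative[where B = B]) (fact D)+
  from this[of _ 0] this[of _ 1] have exp_distr_D2: "exp_distr s (D 2) = s\<^sup>2 * exp_distr s \<phi>" for s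
    by (simp add: numeral_2_eq_2 power2_eq_square D(1))
  define A where "A n = (LINT t|lborel. exp (t * p) * norm (D n t))" for n
  have bound: "norm (exp_distr (Complex p \<tau>) \<phi>) \<le> (A 0 + A 2) * inverse (1 + \<tau>\<^sup>2)" for \<tau>
  proof -
    let ?s = "Complex p \<tau>"
    have "\<tau>\<^sup>2 \<le> (norm ?s)\<^sup>2"
      by (simp add: cmod_power2)
    then have "\<tau>\<^sup>2 * norm (exp_distr ?s \<phi>) \<le> (norm ?s)\<^sup>2 * norm (exp_distr ?s \<phi>)"
      by (rule mult_right_mono) simp
    also have "\<dots> = norm (exp_distr ?s (D 2))"
      by (simp add: exp_distr_D2 norm_mult norm_power)
    also have "\<dots> \<le> A 2"
      using norm_exp_distr_le[of ?s] by (simp add: A_def)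
    finally have "\<tau>\<^sup>2 * norm (exp_distr ?s \<phi>) \<le> A 2" .
    moreover have "norm (exp_distr ?s \<phi>) \<le> A 0"
      using norm_exp_distr_le[of ?s \<phi>] by (simp add: A_def D(1))
    moreover have "1 + \<tau>\<^sup>2 > 0"
      by (simp add: add_pos_nonneg)
    ultimately show ?thesis
      by (simp add: field_simps)
  qed
  have [measurable]: "\<phi> \<in> borel_measurable borel"
    using D(4)[of UNIV 0] D(1) by (simp add: borel_measurable_continuous_onI)
  show ?thesis
  proof (rule Bochner_Integration.integrable_bound)
    show "integrable lborel (\<lambda>\<tau>. (A 0 + A 2) * inverse (1 + \<tau>\<^sup>2))"
      by (intro integrable_mult_right integrable_inverse_one_plus_square)
    show "(\<lambda>\<tau>. exp_distr (Complex p \<tau>) \<phi>) \<in> borel_measurable lborel"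
      unfolding exp_distr_def Complex_eq by measurable
    show "AE \<tau> in lborel. norm (exp_distr (Complex p \<tau>) \<phi>) \<le> norm ((A 0 + A 2) * inverse (1 + \<tau>\<^sup>2))"
      using bound by (intro AE_I2) (metis abs_ge_self order.trans real_norm_def)
  qed
qed

text \<open>On the line \<open>Re s = p\<close> the pairing is the Fourier transform of
  \<open>exp (p * t) * \<phi> t\<close>. The weight equals 1 at \<open>t = 0\<close>, so inversion
  there returns \<open>\<phi> 0\<close> whatever the abscissa.\<close>

lemma inv_laplace_distr_one:
  assumes "test_function \<phi>"
  shows "inv_laplace_distr p (\<lambda>_. 1) \<phi> = dirac \<phi>"
proof -
  obtain D B where D: "D 0 = \<phi>" "\<And>n t. (D n has_vector_derivative D (Suc n) t) (at t)"
    "\<And>n t. B < \<bar>t\<bar> \<Longrightarrow> D n t = 0" "\<And>n A. continuous_on A (D n)"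
    using test_functionE[OF assms] by metis
  let ?\<psi> = "\<lambda>t. exp (of_real (t * p)) * \<phi> t"
    and ?\<psi>' = "\<lambda>t. exp (of_real (t * p)) * D 1 t + of_real p * exp (of_real (t * p)) * \<phi> t"
  have eq: "exp_distr (Complex p \<tau>) \<phi> = (LINT t|lborel. exp (\<i> * of_real (\<tau> * t)) * ?\<psi> t)" for \<tau>
    unfolding exp_distr_def Complex_eq
  proof (intro Bochner_Integration.integral_cong refl)
    fix t
    have "of_real t * (of_real p + \<i> * of_real \<tau>) = \<i> * of_real (\<tau> * t) + of_real (t * p)"
      by (simp add: algebra_simps)
    then show "exp (of_real t * (of_real p + \<i> * of_real \<tau>)) * \<phi> t = exp (\<i> * of_real (\<tau> * t)) * ?\<psi> t"
      by (simp only: exp_add mult.assoc)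
  qed
  have "(LINT \<tau>|lborel. LINT t|lborel. exp (\<i> * of_real (\<tau> * t)) * ?\<psi> t) = 2 * of_real pi * ?\<psi> 0"
  proof (rule fourier_inversion_at_zero)
    fix t :: real
    have "((\<lambda>t. exp (of_real (t * p)) :: complex) has_vector_derivative of_real p * exp (of_real (t * p))) (at t)"
      by (auto intro!: derivative_eq_intros has_vector_derivative_real_field)
    from has_vector_derivative_mult[OF this D(2)[of 0 t]]
    show "(?\<psi> has_vector_derivative ?\<psi>' t) (at t)"
      by (simp add: D(1))
    assume "B < \<bar>t\<bar>"
    then show "?\<psi> t = 0" "?\<psi>' t = 0"
      using D(3)[of t 0] D(3)[of t 1] D(1) by simp_all
  next
    show "continuous_on UNIV ?\<psi>'"
      using D(4)[of UNIV 0] D(4)[of UNIV 1] D(1) by (intro continuous_intros) auto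
    show "integrable lborel (\<lambda>\<tau>. LINT t|lborel. exp (\<i> * of_real (\<tau> * t)) * ?\<psi> t)"
      using exp_distr_integrable_on_line[OF assms, of p] unfolding eq .
  qed
  then show ?thesis
    unfolding eq [symmetric] by (simp add: inv_laplace_distr_def line_integral_def dirac_def)
qed

section \<open>The wave kernel\<close>

theorem theorem4p5:
  fixes \<alpha> \<beta> a\<^sub>1 a\<^sub>2 b\<^sub>1 b\<^sub>2 s\<^sub>0 :: real
  assumes "0 < \<alpha>" and "\<alpha> < 1" and "0 < \<beta>"
    and "0 < a\<^sub>1" and "a\<^sub>1 < a\<^sub>2" and "0 < b\<^sub>1" and "b\<^sub>1 < b\<^sub>2"
    and "a\<^sub>2 * b\<^sub>1 - a\<^sub>1 * b\<^sub>2 = 0"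
    and "a\<^sub>1 > 2 * b\<^sub>1 * cosh (\<beta> * pi / 2) * sqrt (1 + (cot (\<alpha> * pi / 2) * tanh (\<beta> * pi / 2))\<^sup>2)"
    and "a\<^sub>2 > 2 * b\<^sub>2 * cosh (\<beta> * pi / 2) * sqrt (1 + (cot (\<alpha> * pi / 2) * tanh (\<beta> * pi / 2))\<^sup>2)"
    and "a\<^sub>1 > 2 * b\<^sub>1 * cosh (\<beta> * pi / 2) * sqrt (1 + (tan (\<alpha> * pi / 2) * tanh (\<beta> * pi / 2))\<^sup>2)"
    and "a\<^sub>2 > 2 * b\<^sub>2 * cosh (\<beta> * pi / 2) * sqrt (1 + (tan (\<alpha> * pi / 2) * tanh (\<beta> * pi / 2))\<^sup>2)"
    and "0 < s\<^sub>0"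
  shows "(\<forall>x t :: real. x > 0 \<longrightarrow> t > 0 \<longrightarrow>
           line_integrable s\<^sub>0 (\<lambda>s. exp (of_real t * s) * K_hat \<alpha> \<beta> a\<^sub>1 b\<^sub>1 a\<^sub>2 b\<^sub>2 x s) \<and>
           set_integrable lborel {0..}
             (\<lambda>\<tau>. exp (\<tau> * Im (M \<alpha> \<beta> a\<^sub>1 b\<^sub>1 a\<^sub>2 b\<^sub>2 (\<i> * of_real \<tau>)) * x)
                * cos (\<tau> * (t - Re (M \<alpha> \<beta> a\<^sub>1 b\<^sub>1 a\<^sub>2 b\<^sub>2 (\<i> * of_real \<tau>)) * x))) \<and>
           K \<alpha> \<beta> a\<^sub>1 b\<^sub>1 a\<^sub>2 b\<^sub>2 s\<^sub>0 x t =
             of_real (1 / pi * (LINT \<tau>:{0..}|lborel.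
               exp (\<tau> * Im (M \<alpha> \<beta> a\<^sub>1 b\<^sub>1 a\<^sub>2 b\<^sub>2 (\<i> * of_real \<tau>)) * x)
                * cos (\<tau> * (t - Re (M \<alpha> \<beta> a\<^sub>1 b\<^sub>1 a\<^sub>2 b\<^sub>2 (\<i> * of_real \<tau>)) * x)))))
       \<and> (\<forall>t>0. continuous_on {0<..} (\<lambda>x. K \<alpha> \<beta> a\<^sub>1 b\<^sub>1 a\<^sub>2 b\<^sub>2 s\<^sub>0 x t))
       \<and> (\<forall>\<phi>. test_function \<phi> \<longrightarrow>
           line_integrable s\<^sub>0 (\<lambda>s. exp_distr s \<phi> * K_hat \<alpha> \<beta> a\<^sub>1 b\<^sub>1 a\<^sub>2 b\<^sub>2 0 s) \<and>
           K_distr \<alpha> \<beta> a\<^sub>1 b\<^sub>1 a\<^sub>2 b\<^sub>2 s\<^sub>0 0 \<phi> = dirac \<phi>)"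
proof -
  interpret rod \<alpha> \<beta> a\<^sub>1 b\<^sub>1 a\<^sub>2 b\<^sub>2
    using assms by unfold_locales auto
  obtain c C where c: "0 < c"
    and decay: "\<And>s. 0 \<le> Re s \<Longrightarrow> Re s \<le> s\<^sub>0 \<Longrightarrow> c * \<bar>Im s\<bar> powr (1 - \<alpha>) - C \<le> Re (s * N s)"
    using Re_mult_N_lower_bound[of s\<^sub>0] \<open>0 < s\<^sub>0\<close> by auto
  \<comment> \<open>The decay exponent \<open>1 - \<alpha>\<close> is positive because
    \<open>\<alpha> < 1\<close>, and the strip ends at the given line of integration.\<close>
  interpret H: half_plane_symbol N "1 - \<alpha>" s\<^sub>0 c C
  proof
    show "continuous_on ({s. Re s \<ge> 0} - {0}) N"
      by (intro holomorphic_on_imp_continuous_on N_holomorphic) auto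
    show "N holomorphic_on {s. Re s > 0}"
      by (intro N_holomorphic) auto
  qed (use norm_N_le N_cnj c decay assms in auto)
  have K_hat: "K_hat \<alpha> \<beta> a\<^sub>1 b\<^sub>1 a\<^sub>2 b\<^sub>2 x = (\<lambda>s. exp (- s * N s * of_real x))" for x
    by (simp add: fun_eq_iff K_hat_def N_def)
  have K: "K \<alpha> \<beta> a\<^sub>1 b\<^sub>1 a\<^sub>2 b\<^sub>2 s\<^sub>0 x t = inv_laplace s\<^sub>0 (\<lambda>s. exp (- s * N s * of_real x)) t" for x t
    by (simp only: K_def K_hat)
  have K_hat_0: "K_hat \<alpha> \<beta> a\<^sub>1 b\<^sub>1 a\<^sub>2 b\<^sub>2 0 = (\<lambda>_. 1)"
    by (simp add: fun_eq_iff K_hat_def)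
  show ?thesis
  proof (intro conjI allI impI)
    fix x t :: real
    assume "x > 0" "t > 0"
    then have xt: "0 < x" "0 \<le> t" by auto
    show "line_integrable s\<^sub>0 (\<lambda>s. exp (of_real t * s) * K_hat \<alpha> \<beta> a\<^sub>1 b\<^sub>1 a\<^sub>2 b\<^sub>2 x s)"
      unfolding K_hat by (rule H.inv_laplace_line_integrable[OF xt])
    show "set_integrable lborel {0..}
             (\<lambda>\<tau>. exp (\<tau> * Im (M \<alpha> \<beta> a\<^sub>1 b\<^sub>1 a\<^sub>2 b\<^sub>2 (\<i> * of_real \<tau>)) * x)
                * cos (\<tau> * (t - Re (M \<alpha> \<beta> a\<^sub>1 b\<^sub>1 a\<^sub>2 b\<^sub>2 (\<i> * of_real \<tau>)) * x)))"
      using H.inverse_laplace_formula(1)[OF xt] unfolding N_def .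
    show "K \<alpha> \<beta> a\<^sub>1 b\<^sub>1 a\<^sub>2 b\<^sub>2 s\<^sub>0 x t =
             of_real (1 / pi * (LINT \<tau>:{0..}|lborel.
               exp (\<tau> * Im (M \<alpha> \<beta> a\<^sub>1 b\<^sub>1 a\<^sub>2 b\<^sub>2 (\<i> * of_real \<tau>)) * x)
                * cos (\<tau> * (t - Re (M \<alpha> \<beta> a\<^sub>1 b\<^sub>1 a\<^sub>2 b\<^sub>2 (\<i> * of_real \<tau>)) * x))))"
      unfolding K using H.inverse_laplace_formula(2)[OF xt] unfolding N_def .
  next
    fix t :: real
    assume "t > 0"
    then show "continuous_on {0<..} (\<lambda>x. K \<alpha> \<beta> a\<^sub>1 b\<^sub>1 a\<^sub>2 b\<^sub>2 s\<^sub>0 x t)"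
      unfolding K by (intro H.inv_laplace_continuous) simp
  next
    fix \<phi>
    assume \<phi>: "test_function \<phi>"
    show "line_integrable s\<^sub>0 (\<lambda>s. exp_distr s \<phi> * K_hat \<alpha> \<beta> a\<^sub>1 b\<^sub>1 a\<^sub>2 b\<^sub>2 0 s)"
      using exp_distr_integrable_on_line[OF \<phi>] by (simp add: line_integrable_def K_hat_0)
    show "K_distr \<alpha> \<beta> a\<^sub>1 b\<^sub>1 a\<^sub>2 b\<^sub>2 s\<^sub>0 0 \<phi> = dirac \<phi>"
      using inv_laplace_distr_one[OF \<phi>] by (simp add: K_distr_def K_hat_0)
  qed
qed

end
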